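(* Let $K=\mathbb{F}_{p^s}$ be a finite field and set $k=p^s$. Suppose $m\ge 2$ and $k\ge 3$. Then the lattice $L_{\le 2}(\mathrm{AG}(m,K))$ is realizable over $\mathbb{C}$ if and only if $m=2$ and $k=3$.
   Context: $\mathrm{AG}(m,K)$ is the affine geometry: the simple matroid of rank $m+1$ on the ground set $K^m$ whose dependent subsets are the affinely dependent ones. For a simple matroid $\mathcal{M}$, $L_{\le 2}(\mathcal{M})$ is the poset of flats of rank at most $2$, ordered by inclusion. It is said to be realizable over $\mathbb{C}$ if there is a central arrangement $\mathcal{A}$ of linear hyperplanes in some $\mathbb{C}^\ell$ with $L_{\le 2}(\mathcal{M})\cong L_{\le 2}(\mathcal{A})$, where $L_{\le 2}(\mathcal{A})$ is the poset of intersections of hyperplanes of $\mathcal{A}$ of codimension at most $2$, ordered by reverse inclusion. *)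

theory Defs
  imports "HOL-Analysis.Analysis" "Jordan_Normal_Form.VS_Connect"
begin

section \<open>Matroids and their flats of rank at most two\<close>

locale matroid =
  fixes E :: "'a set" and indep :: "'a set \<Rightarrow> bool"
  assumes finite_ground: "finite E"
    and indep_subset_ground: "indep X \<Longrightarrow> X \<subseteq> E"
    and indep_empty: "indep {}"
    and indep_mono: "indep X \<Longrightarrow> Y \<subseteq> X \<Longrightarrow> indep Y"
    and augment: "indep X \<Longrightarrow> indep Y \<Longrightarrow> card X < card Y \<Longrightarrow> \<exists>y\<in>Y - X. indep (insert y X)"
begin

definition rank :: "'a set \<Rightarrow> nat" where
  "rank X = Max (card ` {I. I \<subseteq> X \<and> indep I})"

definition flat :: "'a set \<Rightarrow> bool" where
  "flat F \<longleftrightarrow> F \<subseteq> E \<and> (\<forall>x\<in>E - F. rank F < rank (insert x F))"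

definition flats_le2 :: "'a set set" where
  "flats_le2 = {F. flat F \<and> rank F \<le> 2}"

end

text \<open>Simple: no loops (take \<open>x = y\<close> below) and no two parallel elements.\<close>

locale simple_matroid = matroid +
  assumes simple: "x \<in> E \<Longrightarrow> y \<in> E \<Longrightarrow> indep {x, y}"

section \<open>Affine geometries\<close>

text \<open>The library's \<^const>\<open>affine_dependent\<close> is restricted to real vector spaces; this is the
  same notion over an arbitrary field.\<close>

definition affinely_dependent :: "('k::field ^ 'm) set \<Rightarrow> bool" where
  "affinely_dependent S \<longleftrightarrow>
     (\<exists>T u. finite T \<and> T \<subseteq> S \<and> (\<Sum>v\<in>T. u v) = 0 \<and> (\<exists>v\<in>T. u v \<noteq> 0) \<and> (\<Sum>v\<in>T. u v *s v) = 0)"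

abbreviation affinely_independent :: "('k::field ^ 'm) set \<Rightarrow> bool" where
  "affinely_independent S \<equiv> \<not> affinely_dependent S"

definition homogenize :: "'k::field ^ 'm \<Rightarrow> 'k ^ 'm option" where
  "homogenize x = (\<chi> i. case i of None \<Rightarrow> 1 | Some j \<Rightarrow> x $ j)"

lemma inj_homogenize: "inj homogenize"
proof (rule injI)
  fix x y :: "'k::field ^ 'm" assume "homogenize x = homogenize y"
  then have "homogenize x $ Some j = homogenize y $ Some j" for j by simp
  then show "x = y" by (simp add: homogenize_def Finite_Cartesian_Product.vec_eq_iff)
qed

lemma sum_homogenize_eq_0_iff:
  fixes T :: "('k::field ^ 'm::finite) set"
  shows "(\<Sum>v\<in>T. u v *s homogenize v) = 0 \<longleftrightarrow> (\<Sum>v\<in>T. u v) = 0 \<and> (\<Sum>v\<in>T. u v *s v) = 0"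
  by (auto simp: Finite_Cartesian_Product.vec_eq_iff homogenize_def sum_component split_option_all
      split: option.split cong: sum.cong)

lemma affinely_dependent_iff_homogenize:
  fixes S :: "('k::field ^ 'm::finite) set"
  shows "affinely_dependent S \<longleftrightarrow> vec.dependent (homogenize ` S)"
proof
  assume "affinely_dependent S"
  then obtain T u where T: "finite T" "T \<subseteq> S" "\<exists>v\<in>T. u v \<noteq> 0"
    "(\<Sum>v\<in>T. u v *s homogenize v) = 0"
    unfolding affinely_dependent_def sum_homogenize_eq_0_iff by blast
  have i: "inj_on homogenize T" by (rule inj_on_subset[OF inj_homogenize]) simp
  define w where "w = u \<circ> the_inv homogenize"
  have w: "w (homogenize v) = u v" for v
    by (simp add: w_def the_inv_f_f[OF inj_homogenize])
  have "(\<Sum>v\<in>homogenize ` T. w v *s v) = 0"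
    using T(4) by (simp add: sum.reindex[OF i] w)
  moreover have "\<exists>v\<in>homogenize ` T. w v \<noteq> 0" using T(3) w by auto
  ultimately show "vec.dependent (homogenize ` S)"
    unfolding vec.dependent_explicit using T(1,2) by blast
next
  assume "vec.dependent (homogenize ` S)"
  then obtain T' w where T': "finite T'" "T' \<subseteq> homogenize ` S" "(\<Sum>v\<in>T'. w v *s v) = 0"
    "\<exists>v\<in>T'. w v \<noteq> 0"
    unfolding vec.dependent_explicit by blast
  obtain T where T: "T \<subseteq> S" "T' = homogenize ` T" using T'(2) by (meson subset_image_iff)
  have i: "inj_on homogenize T" by (rule inj_on_subset[OF inj_homogenize]) simp
  have "(\<Sum>v\<in>T. w (homogenize v) *s homogenize v) = 0"
    using T'(3) by (simp add: T(2) sum.reindex[OF i])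
  moreover have "finite T" using T'(1) T(2) i finite_imageD by blast
  moreover have "\<exists>v\<in>T. w (homogenize v) \<noteq> 0" using T'(4) T(2) by blast
  ultimately show "affinely_dependent S"
    unfolding affinely_dependent_def sum_homogenize_eq_0_iff
    using T(1) by (intro exI[of _ T] exI[of _ "w \<circ> homogenize"]) simp
qed

lemma simple_matroid_AG:
  "simple_matroid (UNIV :: ('k::{field,finite} ^ 'm::finite) set) affinely_independent"
proof
  show "finite (UNIV :: ('k ^ 'm) set)" by simp
  show "affinely_independent ({} :: ('k ^ 'm) set)"
    by (auto simp: affinely_dependent_def)
next
  fix X Y :: "('k ^ 'm) set"
  assume "affinely_independent X" "Y \<subseteq> X"
  then show "affinely_independent Y"
    unfolding affinely_dependent_iff_homogenize by (meson image_mono vec.dependent_mono)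
next
  fix X Y :: "('k ^ 'm) set"
  assume X: "affinely_independent X" and Y: "affinely_independent Y" and less: "card X < card Y"
  have c: "card (homogenize ` Z) = card Z" for Z :: "('k ^ 'm) set"
    by (intro card_image inj_on_subset[OF inj_homogenize]) simp
  have "\<not> homogenize ` Y \<subseteq> vec.span (homogenize ` X)"
  proof
    assume "homogenize ` Y \<subseteq> vec.span (homogenize ` X)"
    with Y have "card (homogenize ` Y) \<le> card (homogenize ` X)"
      unfolding affinely_dependent_iff_homogenize
      using vec.independent_span_bound[of "homogenize ` X" "homogenize ` Y"] by simp
    then show False using less c by simp
  qed
  then obtain y where y: "y \<in> Y" "homogenize y \<notin> vec.span (homogenize ` X)" by blast
  then have "y \<notin> X" using vec.span_base by blast
  moreover have "affinely_independent (insert y X)"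
    using X y(2) unfolding affinely_dependent_iff_homogenize
    by (simp add: vec.independent_insert)
  ultimately show "\<exists>y\<in>Y - X. affinely_independent (insert y X)" using y(1) by blast
next
  fix x y :: "'k ^ 'm"
  show "affinely_independent {x, y}"
  proof (cases "x = y")
    case True
    have "homogenize y \<noteq> 0"
      by (metis homogenize_def option.simps(4) vec_lambda_beta zero_index zero_neq_one)
    with True show ?thesis by (simp add: affinely_dependent_iff_homogenize)
  next
    case False
    have "homogenize x \<notin> vec.span {homogenize y}"
    proof
      assume "homogenize x \<in> vec.span {homogenize y}"
      then obtain a where a: "homogenize x = a *s homogenize y"
        by (auto simp: vec.span_singleton)
      then have "homogenize x $ None = a * homogenize y $ None" by simp
      then have "a = 1" by (simp add: homogenize_def)
      with a have "homogenize x = homogenize y" by simp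
      then show False using False injD[OF inj_homogenize] by blast
    qed
    moreover have "homogenize y \<noteq> 0"
      by (metis homogenize_def option.simps(4) vec_lambda_beta zero_index zero_neq_one)
    ultimately show ?thesis
      by (simp add: affinely_dependent_iff_homogenize vec.independent_insert)
  qed
qed simp_all

lemma rank_AG: "matroid.rank affinely_independent (UNIV :: ('k::{field,finite} ^ 'm::finite) set) = CARD('m) + 1"
proof -
  interpret simple_matroid "UNIV :: ('k ^ 'm) set" affinely_independent
    by (rule simple_matroid_AG)
  let ?R = "range (homogenize :: 'k ^ 'm \<Rightarrow> _)"
  have c: "card (homogenize ` Z) = card Z" for Z :: "('k ^ 'm) set"
    by (intro card_image inj_on_subset[OF inj_homogenize]) simp
  have ax: "axis i 1 \<in> vec.span ?R" for i :: "'m option"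
  proof (cases i)
    case None
    have "axis i 1 = (homogenize 0 :: 'k ^ 'm option)"
      unfolding None
      by (auto simp: Finite_Cartesian_Product.vec_eq_iff homogenize_def axis_def split: option.split)
    then show ?thesis by (simp add: vec.span_base)
  next
    case (Some j)
    have "axis i 1 = (homogenize (axis j 1) - homogenize 0 :: 'k ^ 'm option)"
      unfolding Some
      by (auto simp: Finite_Cartesian_Product.vec_eq_iff homogenize_def axis_def split: option.split)
    then show ?thesis by (simp add: vec.span_base vec.span_diff)
  qed
  have "UNIV = vec.span (cart_basis :: ('k ^ 'm option) set)"
    by (simp add: vec.span_Basis)
  also have "\<dots> \<subseteq> vec.span ?R"
    by (rule vec.span_minimal) (use ax in \<open>auto simp: cart_basis_def\<close>)
  finally have "vec.dim ?R = vec.dim (UNIV :: ('k ^ 'm option) set)"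
    by (metis top.extremum_uniqueI vec.dim_span)
  then have dim: "vec.dim ?R = CARD('m) + 1" by (simp add: vec.dim_UNIV vec.dimension_def card_cart_basis)
  obtain B where B: "B \<subseteq> ?R" "vec.independent B" "card B = CARD('m) + 1"
    using vec.basis_exists[of ?R] dim by metis
  obtain I where I: "B = homogenize ` I" using B(1) by (meson subset_image_iff)
  have ex: "affinely_independent I" "card I = CARD('m) + 1"
    using B(2,3) c[of I] unfolding I affinely_dependent_iff_homogenize by simp_all
  have le: "card J \<le> CARD('m) + 1" if "affinely_independent J" for J :: "('k ^ 'm) set"
    using vec.independent_card_le_dim[of "homogenize ` J" ?R] that dim c[of J]
    unfolding affinely_dependent_iff_homogenize by auto
  show ?thesis
    unfolding rank_def
  proof (rule Max_eqI)
    show "CARD('m) + 1 \<in> card ` {J :: ('k ^ 'm) set. J \<subseteq> UNIV \<and> affinely_independent J}"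
      using ex by force
  qed (use le in auto)
qed

section \<open>Arrangements of linear hyperplanes in complex space\<close>

definition linear_hyperplane :: "nat \<Rightarrow> complex Matrix.vec set \<Rightarrow> bool" where
  "linear_hyperplane l H \<longleftrightarrow>
     (\<exists>a\<in>carrier_vec l. a \<noteq> 0\<^sub>v l \<and> H = {v \<in> carrier_vec l. scalar_prod a v = 0})"

definition central_arrangement :: "nat \<Rightarrow> complex Matrix.vec set set \<Rightarrow> bool" where
  "central_arrangement l \<A> \<longleftrightarrow> finite \<A> \<and> (\<forall>H\<in>\<A>. linear_hyperplane l H)"

definition codim :: "nat \<Rightarrow> complex Matrix.vec set \<Rightarrow> nat" where
  "codim l X = l - vectorspace.dim class_ring (module_vec TYPE(complex) l\<lparr>carrier := X\<rparr>)"

text \<open>The intersection with the ambient space makes it the empty intersection.\<close>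

definition intersections_le2 :: "nat \<Rightarrow> complex Matrix.vec set set \<Rightarrow> complex Matrix.vec set set" where
  "intersections_le2 l \<A> = {X. (\<exists>\<B>\<subseteq>\<A>. X = carrier_vec l \<inter> \<Inter>\<B>) \<and> codim l X \<le> 2}"

section \<open>Realizability\<close>

definition poset_isomorphic ::
    "'a set \<Rightarrow> ('a \<Rightarrow> 'a \<Rightarrow> bool) \<Rightarrow> 'b set \<Rightarrow> ('b \<Rightarrow> 'b \<Rightarrow> bool) \<Rightarrow> bool" where
  "poset_isomorphic P leP Q leQ \<longleftrightarrow>
     (\<exists>f. bij_betw f P Q \<and> (\<forall>x\<in>P. \<forall>y\<in>P. leP x y \<longleftrightarrow> leQ (f x) (f y)))"

definition (in simple_matroid) flats_le2_realizable :: bool where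
  "flats_le2_realizable \<longleftrightarrow>
     (\<exists>l \<A>. central_arrangement l \<A> \<and>
        poset_isomorphic flats_le2 (\<subseteq>) (intersections_le2 l \<A>) (\<supseteq>))"

end

theory Submission
  imports Defs "Jordan_Normal_Form.DL_Rank"
begin

text \<open>
  A realization of the rank-two truncation amounts to complex vectors, one for each point, such that
  three of them are linearly dependent exactly when the points are collinear.

  For \<open>k \<ge> 4\<close> Desargues' theorem shows that the lines representing a parallel class all
  pass through one further point. Taking two such vanishing points as points at infinity represents
  the affine plane by \<open>(x, y) \<mapsto> (f x, g y)\<close>; collinearity of suitable triples then forces
  \<open>f / f 1\<close> to be an injective ring homomorphism from a finite field into the complex numbers.

  For \<open>k = 3\<close> every plane through a point is represented by a Hesse configuration, which
  contains a primitive cube root of unity \<open>t a b\<close> depending on the two directions spanning the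
  plane. After suitable scaling \<open>N (a + b) = t N a + t\<^sup>2 N b\<close> modulo the vector of the point,
  and \<open>t a (- b) = (t a b)\<^sup>2\<close>: the roots behave like a nowhere degenerate alternating form.
  In three dimensions such a form is degenerate, which contradicts the existence of a representation.
\<close>

no_notation inner (infix "\<bullet>" 70)
no_notation vec_nth (infixl "$" 90)

section \<open>Linear dependence of three vectors\<close>

text \<open>Flats of rank three and more are not recorded, so nothing bounds the dimension spanned
  by the normals from below: four points in general position may receive dependent vectors. Only
  triples carry information, and every contradiction has to end in a relation between three vectors
  already known to be independent. For this reason the last step for k = 3 compares two expansions
  of one vector and, for each choice of the cube roots involved, folds the resulting relation
  between four vectors into one between three. For k \<ge> 4 a coordinate plane suffices, whatever m
  is. The size of K matters twice: four elements leave room for the Desargues configuration, and an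
  element other than 0 and 1 kills the only possible defect of additivity. Over three elements
  concurrence really fails: in the Hesse configuration a parallel class can be represented by the
  sides of a triangle.\<close>

definition dep3 :: "('i \<Rightarrow> 'c::field) \<Rightarrow> ('i \<Rightarrow> 'c) \<Rightarrow> ('i \<Rightarrow> 'c) \<Rightarrow> bool" where
  "dep3 u v w \<longleftrightarrow> (\<exists>\<alpha> \<beta> \<gamma>. (\<alpha> \<noteq> 0 \<or> \<beta> \<noteq> 0 \<or> \<gamma> \<noteq> 0) \<and> (\<forall>i. \<alpha> * u i + \<beta> * v i + \<gamma> * w i = 0))"

lemma dep3_rotateD: "dep3 u v w \<Longrightarrow> dep3 v w u"
  unfolding dep3_def by (metis add.commute add.assoc)

lemma dep3_swapD: "dep3 u v w \<Longrightarrow> dep3 v u w"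
  unfolding dep3_def by (metis add.commute)

lemma dep3_swap12: "dep3 u v w \<longleftrightarrow> dep3 v u w"
  using dep3_swapD by blast

lemma dep3_swap23: "dep3 u v w \<longleftrightarrow> dep3 u w v"
  using dep3_swapD dep3_rotateD by blast

lemma dep3_rotate: "dep3 u v w \<longleftrightarrow> dep3 v w u"
  by (metis dep3_swap12 dep3_swap23)

lemma dep3_same [simp]: "dep3 u u w"
  unfolding dep3_def by (rule exI[of _ 1], rule exI[of _ "-1"], rule exI[of _ 0]) simp

lemma indep3D:
  assumes "\<not> dep3 u v w" "\<And>i. \<alpha> * u i + \<beta> * v i + \<gamma> * w i = 0"
  shows "\<alpha> = 0" "\<beta> = 0" "\<gamma> = 0"
  using assms unfolding dep3_def by blast+

text \<open>The minor in rows \<open>i\<close>, \<open>j\<close>, \<open>k\<close> of the matrix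
  with columns \<open>u\<close>, \<open>v\<close>, \<open>w\<close>, expanded along
  \<open>w\<close>, so that the 2-by-2 minors of \<open>u\<close> and \<open>v\<close> appear as
  coefficients.\<close>

definition det3 :: "('i \<Rightarrow> 'c::field) \<Rightarrow> ('i \<Rightarrow> 'c) \<Rightarrow> ('i \<Rightarrow> 'c) \<Rightarrow> 'i \<Rightarrow> 'i \<Rightarrow> 'i \<Rightarrow> 'c" where
  "det3 u v w i j k = (u j * v k - u k * v j) * w i + (u k * v i - u i * v k) * w j
     + (u i * v j - u j * v i) * w k"

text \<open>Some 2-by-2 minor of \<open>u\<close> and \<open>v\<close> is nonzero, say in rows
  \<open>i\<close> and \<open>j\<close>. If every 3-by-3 minor through these rows vanished,
  expanding along the varying row \<open>k\<close> would give one relation valid in all coordinates,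
  with that 2-by-2 minor as the coefficient of \<open>w\<close>.\<close>

lemma indep3_imp_det3:
  assumes "\<not> dep3 u v w"
  obtains i j k where "det3 u v w i j k \<noteq> 0"
proof -
  have "\<exists>i j. u i * v j - u j * v i \<noteq> 0"
  proof (rule ccontr)
    assume "\<not> ?thesis"
    then have m: "u i * v j = u j * v i" for i j by simp
    show False
    proof (cases "\<forall>i. u i = 0")
      case True
      then show ?thesis using indep3D(1)[OF assms, of 1 0 0] by simp
    next
      case False
      then obtain i where "u i \<noteq> 0" by blast
      moreover have "v i * u j + (- u i) * v j + 0 * w j = 0" for j using m[of i j] by (simp add: mult.commute)
      ultimately show ?thesis using indep3D(2)[OF assms, of "v i" "- u i" 0] by simp
    qed
  qed
  then obtain i j where m: "u i * v j - u j * v i \<noteq> 0" by blast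
  have "\<exists>k. det3 u v w i j k \<noteq> 0"
  proof (rule ccontr)
    assume "\<not> ?thesis"
    then have d: "det3 u v w i j k = 0" for k by blast
    have "(v i * w j - v j * w i) * u k + (u j * w i - u i * w j) * v k
        + (u i * v j - u j * v i) * w k = det3 u v w i j k" for k
      by (simp add: det3_def algebra_simps)
    then have "(v i * w j - v j * w i) * u k + (u j * w i - u i * w j) * v k
        + (u i * v j - u j * v i) * w k = 0" for k
      by (simp only: d)
    then show False using indep3D(3)[OF assms] m by blast
  qed
  then show thesis using that by blast
qed

lemma det3_imp_indep3:
  assumes "det3 u v w i j k \<noteq> 0"
  shows "\<not> dep3 u v w"
proof
  assume "dep3 u v w"
  then obtain \<alpha> \<beta> \<gamma> where nz: "\<alpha> \<noteq> 0 \<or> \<beta> \<noteq> 0 \<or> \<gamma> \<noteq> 0"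
    and r: "\<And>i. \<alpha> * u i + \<beta> * v i + \<gamma> * w i = 0"
    unfolding dep3_def by blast
  let ?r = "\<lambda>i. \<alpha> * u i + \<beta> * v i + \<gamma> * w i"
  \<comment> \<open>Cramer's rule: weighting the coordinates \<open>i\<close>, \<open>j\<close>,
    \<open>k\<close> of the relation by the cofactors of one column leaves the coefficient of that
    column times the determinant.\<close>
  have "\<alpha> * det3 u v w i j k
      = ?r i * (v j * w k - v k * w j) + ?r j * (v k * w i - v i * w k) + ?r k * (v i * w j - v j * w i)"
    "\<beta> * det3 u v w i j k
      = ?r i * (w j * u k - w k * u j) + ?r j * (w k * u i - w i * u k) + ?r k * (w i * u j - w j * u i)"
    "\<gamma> * det3 u v w i j k
      = ?r i * (u j * v k - u k * v j) + ?r j * (u k * v i - u i * v k) + ?r k * (u i * v j - u j * v i)"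
    unfolding det3_def by (simp_all add: algebra_simps)
  then have "\<alpha> * det3 u v w i j k = 0" "\<beta> * det3 u v w i j k = 0" "\<gamma> * det3 u v w i j k = 0"
    by (simp_all add: r)
  then show False using nz assms by simp
qed

lemma dep3_same' [simp]: "dep3 w u u" "dep3 u w u"
  using dep3_same dep3_rotate dep3_swap23 by metis+

lemma dep3_imp_det3: "dep3 u v w \<Longrightarrow> det3 u v w i j k = 0"
  using det3_imp_indep3[of u v w i j k] by auto

text \<open>Since \<open>p\<close>, \<open>q\<close>, \<open>r\<close> are independent, a dependence
  passes to the coefficient vectors; the conclusion is the vanishing of the determinant of the
  coefficient matrix. Collinear triples are turned into polynomial equations by this lemma.\<close>

lemma det3_coordinates:
  assumes indep: "\<not> dep3 p q r"
    and "dep3 (\<lambda>i. x1 * p i + y1 * q i + z1 * r i) (\<lambda>i. x2 * p i + y2 * q i + z2 * r i)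
      (\<lambda>i. x3 * p i + y3 * q i + z3 * r i)"
  shows "(x1 * y2 - y1 * x2) * z3 + (y1 * z2 - z1 * y2) * x3 + (z1 * x2 - x1 * z2) * y3 = 0"
proof -
  obtain \<alpha> \<beta> \<gamma> where nz: "\<alpha> \<noteq> 0 \<or> \<beta> \<noteq> 0 \<or> \<gamma> \<noteq> 0"
    and e: "\<And>i. \<alpha> * (x1 * p i + y1 * q i + z1 * r i) + \<beta> * (x2 * p i + y2 * q i + z2 * r i)
      + \<gamma> * (x3 * p i + y3 * q i + z3 * r i) = 0"
    using assms(2) unfolding dep3_def by blast
  have "(\<alpha> * x1 + \<beta> * x2 + \<gamma> * x3) * p i + (\<alpha> * y1 + \<beta> * y2 + \<gamma> * y3) * q i
      + (\<alpha> * z1 + \<beta> * z2 + \<gamma> * z3) * r i = 0" for i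
    using e[of i] by (simp add: algebra_simps)
  from indep3D[OF indep this]
  have c: "\<alpha> * x1 + \<beta> * x2 + \<gamma> * x3 = 0" "\<alpha> * y1 + \<beta> * y2 + \<gamma> * y3 = 0" "\<alpha> * z1 + \<beta> * z2 + \<gamma> * z3 = 0" .
  let ?c = "\<lambda>x y z (i :: nat). if i = 0 then x else if i = 1 then y else z"
  have "dep3 (?c x1 y1 z1) (?c x2 y2 z2) (?c x3 y3 z3)"
    unfolding dep3_def using nz c by (intro exI[of _ \<alpha>] exI[of _ \<beta>] exI[of _ \<gamma>]) simp
  then have "det3 (?c x1 y1 z1) (?c x2 y2 z2) (?c x3 y3 z3) 0 1 2 = 0" by (rule dep3_imp_det3)
  then show ?thesis by (simp add: det3_def add_ac)
qed

section \<open>Codimension at most two\<close>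

text \<open>Padding by zero turns vectors of every length into functions on the naturals, so that
  \<open>dep3\<close> needs no carrier set; a minor with an index beyond the length
  vanishes.\<close>

definition coord :: "nat \<Rightarrow> 'c::zero Matrix.vec \<Rightarrow> nat \<Rightarrow> 'c" where
  "coord l a i = (if i < l then a $ i else 0)"

text \<open>Cramer's rule in three rows with a nonzero minor: the solution is supported on these
  rows, and its entries are the cofactors of \<open>c\<close> divided by the minor.\<close>

lemma dual_vector:
  fixes a b c :: "'c::field Matrix.vec"
  assumes a: "a \<in> carrier_vec l" and b: "b \<in> carrier_vec l" and c: "c \<in> carrier_vec l"
    and "\<not> dep3 (coord l a) (coord l b) (coord l c)"
  obtains v where "v \<in> carrier_vec l" "a \<bullet> v = 0" "b \<bullet> v = 0" "c \<bullet> v = 1"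
proof -
  let ?a = "coord l a" and ?b = "coord l b" and ?c = "coord l c"
  obtain i j k where d: "det3 ?a ?b ?c i j k \<noteq> 0"
    using indep3_imp_det3[OF assms(4)] .
  then have "i < l \<and> j < l \<and> k < l"
    unfolding det3_def coord_def by (auto split: if_splits)
  then have l: "i < l" "j < l" "k < l" by auto
  define D where "D = det3 ?a ?b ?c i j k"
  have D: "D \<noteq> 0" using d D_def by simp
  let ?x = "(?a j * ?b k - ?a k * ?b j) / D"
  let ?y = "(?a k * ?b i - ?a i * ?b k) / D"
  let ?z = "(?a i * ?b j - ?a j * ?b i) / D"
  define v where "v = ?x \<cdot>\<^sub>v unit_vec l i + ?y \<cdot>\<^sub>v unit_vec l j + ?z \<cdot>\<^sub>v unit_vec l k"
  have s: "e \<bullet> v = ?x * coord l e i + ?y * coord l e j + ?z * coord l e k" if "e \<in> carrier_vec l" for e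
    using that l unfolding v_def by (simp add: scalar_prod_add_distrib[of _ l] coord_def)
  have "?a i * ?x + ?a j * ?y + ?a k * ?z = 0" "?b i * ?x + ?b j * ?y + ?b k * ?z = 0"
    using D by (simp_all add: field_simps)
  moreover have "?c i * ?x + ?c j * ?y + ?c k * ?z = 1"
    using D by (simp add: field_simps) (simp add: D_def det3_def algebra_simps)
  moreover have "v \<in> carrier_vec l" unfolding v_def by simp
  ultimately show thesis using that[of v] s a b c by (simp add: mult.commute)
qed

section \<open>Subspaces of complex coordinate space and rank-nullity\<close>

lemma (in vectorspace) fin_dim_subspace:
  assumes X: "subspace K X V" and fd: fin_dim
  shows "vectorspace.fin_dim K (vs X)"
proof -
  interpret X: vectorspace K "vs X" by (rule subspace_is_vs[OF X])
  have XV: "X \<subseteq> carrier V" using X by (simp add: subspace_def submodule_def)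
  have sub: "submodule K X V" using X by simp
  have "\<exists>A. finite A \<and> maximal A (\<lambda>S. S \<subseteq> carrier (vs X) \<and> X.lin_indpt S)"
  proof (rule maximal_exists[where ?N = dim and ?B = "{}"])
    fix A assume "A \<subseteq> carrier (vs X) \<and> X.lin_indpt A"
    then have "A \<subseteq> carrier V" "lin_indpt A"
      using XV span_li_not_depend(2)[OF _ sub] by auto
    then show "finite A \<and> card A \<le> dim" using li_le_dim[OF fd] by blast
  qed (auto simp: X.lin_dep_def)
  then obtain A where A: "finite A" "maximal A (\<lambda>S. S \<subseteq> carrier (vs X) \<and> X.lin_indpt S)" by blast
  show ?thesis
    using X.max_li_is_basis[OF A(2)] A(1) unfolding X.basis_def X.fin_dim_def by blast
qed

lemma (in vectorspace) dim_mono_subspace: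
  assumes X: "subspace K X V" and Y: "subspace K Y V" and "X \<subseteq> Y" and fd: fin_dim
  shows "vectorspace.dim K (vs X) \<le> vectorspace.dim K (vs Y)"
proof -
  interpret Y: vectorspace K "vs Y" by (rule subspace_is_vs[OF Y])
  have "subspace K X (vs Y)" by (rule nested_subspaces[OF Y X \<open>X \<subseteq> Y\<close>])
  then show ?thesis
    using Y.subspace_dim[of X] fin_dim_subspace[OF Y fd] fin_dim_subspace[OF X fd] by simp
qed

abbreviation linear_subspace :: "nat \<Rightarrow> complex Matrix.vec set \<Rightarrow> bool" where
  "linear_subspace l X \<equiv> subspace class_ring X (module_vec TYPE(complex) l)"

lemma linear_subspaceI:
  assumes "X \<subseteq> carrier_vec l" "0\<^sub>v l \<in> X"
    and "\<And>v w. v \<in> X \<Longrightarrow> w \<in> X \<Longrightarrow> v + w \<in> X" "\<And>c v. v \<in> X \<Longrightarrow> c \<cdot>\<^sub>v v \<in> X"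
  shows "linear_subspace l X"
  using assms vec_vs vec_module unfolding subspace_def submodule_def
  by (auto simp: module_vec_simps class_ring_simps)

text \<open>Pairing with a list of normals, seen as one linear map. Its kernel is the intersection
  of the hyperplanes, so rank-nullity reads the codimension of an intersection off the rank of this
  map.\<close>

definition eval_at :: "'c::semiring_0 Matrix.vec list \<Rightarrow> 'c Matrix.vec \<Rightarrow> 'c Matrix.vec" where
  "eval_at as v = Matrix.vec (length as) (\<lambda>i. as ! i \<bullet> v)"

definition common_kernel :: "nat \<Rightarrow> 'c::semiring_0 Matrix.vec list \<Rightarrow> 'c Matrix.vec set" where
  "common_kernel l as = {v \<in> carrier_vec l. \<forall>a\<in>set as. a \<bullet> v = 0}"

lemma linear_map_eval_at:
  fixes as :: "complex Matrix.vec list"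
  assumes "set as \<subseteq> carrier_vec l"
  shows "linear_map class_ring (module_vec TYPE(complex) l) (module_vec TYPE(complex) (length as)) (eval_at as)"
proof -
  interpret V: vec_space "TYPE(complex)" l .
  interpret W: vec_space "TYPE(complex)" "length as" .
  have c: "as ! i \<in> carrier_vec l" if "i < length as" for i
    using assms that by auto
  have "eval_at as \<in> module_hom class_ring V.V W.V"
    unfolding module_hom_def eval_at_def module_vec_simps class_ring_simps
    by (auto intro!: eq_vecI simp: scalar_prod_add_distrib[OF c] scalar_prod_smult_distrib[OF c])
  then show ?thesis
    unfolding linear_map_def mod_hom_def mod_hom_axioms_def
    using vec_vs vec_module by blast
qed

lemma vec_zero_iff: "Matrix.vec n f = 0\<^sub>v n \<longleftrightarrow> (\<forall>i<n. f i = 0)"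
  by (auto simp: vec_eq_iff)

lemma kernel_eval_at:
  assumes "set as \<subseteq> carrier_vec l"
  shows "mod_hom.ker (module_vec TYPE(complex) l) (module_vec TYPE(complex) (length as)) (eval_at as)
    = common_kernel l as"
proof -
  interpret linear_map class_ring "module_vec TYPE(complex) l" "module_vec TYPE(complex) (length as)" "eval_at as"
    by (rule linear_map_eval_at[OF assms])
  show ?thesis
    unfolding ker_def common_kernel_def eval_at_def module_vec_simps
    by (simp add: vec_zero_iff all_set_conv_all_nth)
qed

lemma linear_subspace_common_kernel:
  fixes as :: "complex Matrix.vec list"
  assumes "set as \<subseteq> carrier_vec l"
  shows "linear_subspace l (common_kernel l as)"
  using linear_map.kerT_is_subspace[OF linear_map_eval_at[OF assms]] kernel_eval_at[OF assms] by simp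

lemma fin_dim_vec: "vectorspace.fin_dim class_ring (module_vec TYPE(complex) l)"
  and dim_module_vec: "vectorspace.dim class_ring (module_vec TYPE(complex) l) = l"
proof -
  interpret V: vec_space "TYPE(complex)" l .
  show "vectorspace.fin_dim class_ring (module_vec TYPE(complex) l)" by (rule V.fin_dim)
  show "vectorspace.dim class_ring (module_vec TYPE(complex) l) = l" by (rule V.dim_is_n)
qed

lemma codim_common_kernel_le:
  assumes "set as \<subseteq> carrier_vec l"
  shows "codim l (common_kernel l as) \<le> length as"
proof -
  let ?V = "module_vec TYPE(complex) l" and ?W = "module_vec TYPE(complex) (length as)"
  interpret linear_map class_ring ?V ?W "eval_at as"
    by (rule linear_map_eval_at[OF assms])
  have "vectorspace.dim class_ring (W.vs imT) \<le> vectorspace.dim class_ring (W.vs (carrier ?W))"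
    using W.dim_mono_subspace[OF imT_is_subspace, of "carrier ?W"]
      W.subspace_dim[OF imT_is_subspace fin_dim_vec W.fin_dim_subspace[OF imT_is_subspace fin_dim_vec]]
    by simp
  then have "vectorspace.dim class_ring (W.vs imT) \<le> length as" by (simp add: dim_module_vec)
  then show ?thesis
    using rank_nullity[OF fin_dim_vec] unfolding codim_def kernel_eval_at[OF assms] dim_module_vec by simp
qed

text \<open>For independent \<open>a\<close>, \<open>b\<close>, \<open>c\<close> the three dual
  vectors make the evaluation map onto; its kernel then has codimension 3, and \<open>X\<close>,
  contained in it, cannot have codimension at most 2.\<close>

lemma codim_le2_imp_dep3:
  assumes X: "linear_subspace l X" and codim: "codim l X \<le> 2"
    and c: "a \<in> carrier_vec l" "b \<in> carrier_vec l" "c \<in> carrier_vec l"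
    and zero: "\<And>v. v \<in> X \<Longrightarrow> a \<bullet> v = 0 \<and> b \<bullet> v = 0 \<and> c \<bullet> v = 0"
  shows "dep3 (coord l a) (coord l b) (coord l c)"
proof (rule ccontr)
  assume nd: "\<not> ?thesis"
  obtain u where u: "u \<in> carrier_vec l" "b \<bullet> u = 0" "c \<bullet> u = 0" "a \<bullet> u = 1"
    using dual_vector[OF c(2,3,1)] nd by (metis dep3_rotate)
  obtain v where v: "v \<in> carrier_vec l" "c \<bullet> v = 0" "a \<bullet> v = 0" "b \<bullet> v = 1"
    using dual_vector[OF c(3,1,2)] nd by (metis dep3_rotate)
  obtain w where w: "w \<in> carrier_vec l" "a \<bullet> w = 0" "b \<bullet> w = 0" "c \<bullet> w = 1"
    using dual_vector[OF c(1,2,3)] nd by metis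
  let ?as = "[a, b, c]"
  have as: "set ?as \<subseteq> carrier_vec l" using c by simp
  let ?V = "module_vec TYPE(complex) l" and ?W = "module_vec TYPE(complex) (length ?as)"
  interpret linear_map class_ring ?V ?W "eval_at ?as"
    by (rule linear_map_eval_at[OF as])
  have "carrier ?W \<subseteq> imT"
  proof
    fix y assume "y \<in> carrier ?W"
    then have y: "y \<in> carrier_vec 3" by (simp add: module_vec_simps numeral_3_eq_3)
    let ?x = "y $ 0 \<cdot>\<^sub>v u + y $ 1 \<cdot>\<^sub>v v + y $ 2 \<cdot>\<^sub>v w"
    have x: "?x \<in> carrier_vec l" using u v w by simp
    have "a \<bullet> ?x = y $ 0" "b \<bullet> ?x = y $ 1" "c \<bullet> ?x = y $ 2"
      using u v w c by (simp_all add: scalar_prod_add_distrib[of _ l] )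
    then have "eval_at ?as ?x = y"
      using y unfolding eval_at_def
      by (intro eq_vecI) (auto simp: less_Suc_eq numeral_3_eq_3 numeral_2_eq_2)
    then show "y \<in> imT" unfolding im_def using x by (force simp: module_vec_simps)
  qed
  then have "imT = carrier ?W" using imT_is_subspace unfolding subspace_def submodule_def by blast
  then have "vectorspace.dim class_ring (W.vs imT) = 3" using dim_module_vec[of 3] by (simp add: numeral_3_eq_3)
  then have r: "3 + vectorspace.dim class_ring (V.vs (common_kernel l ?as)) = l"
    using rank_nullity[OF fin_dim_vec] unfolding kernel_eval_at[OF as] dim_module_vec by simp
  have "X \<subseteq> carrier ?V" using X by (simp add: subspace_def submodule_def)
  then have "X \<subseteq> common_kernel l ?as"
    using zero unfolding common_kernel_def by (auto simp: module_vec_simps)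
  then have "vectorspace.dim class_ring (V.vs X) \<le> vectorspace.dim class_ring (V.vs (common_kernel l ?as))"
    by (rule V.dim_mono_subspace[OF X linear_subspace_common_kernel[OF as] _ fin_dim_vec])
  then show False using r codim unfolding codim_def by linarith
qed

section \<open>Realizability in terms of normal vectors\<close>

lemma lincomb_scalar_prod:
  fixes a b c w :: "'c::field Matrix.vec"
  assumes "a \<in> carrier_vec l" "b \<in> carrier_vec l" "c \<in> carrier_vec l" "w \<in> carrier_vec l"
    and "\<And>i. \<alpha> * coord l a i + \<beta> * coord l b i + \<gamma> * coord l c i = 0"
  shows "\<alpha> * (a \<bullet> w) + \<beta> * (b \<bullet> w) + \<gamma> * (c \<bullet> w) = 0"
proof -
  have s: "e \<bullet> w = (\<Sum>i<l. coord l e i * w $ i)" if "e \<in> carrier_vec l" for e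
    using assms(4) that unfolding scalar_prod_def by (auto simp: coord_def atLeast0LessThan intro: sum.cong)
  have "\<alpha> * (a \<bullet> w) + \<beta> * (b \<bullet> w) + \<gamma> * (c \<bullet> w)
      = (\<Sum>i<l. (\<alpha> * coord l a i + \<beta> * coord l b i + \<gamma> * coord l c i) * w $ i)"
    using assms(1-3) by (simp add: s sum_distrib_left sum.distrib algebra_simps)
  then show ?thesis using assms(5) by simp
qed

lemma common_kernel_Nil: "common_kernel l [] = carrier_vec l"
  by (simp add: common_kernel_def)

lemma linear_hyperplane_iff:
  "linear_hyperplane l H \<longleftrightarrow> (\<exists>a\<in>carrier_vec l. a \<noteq> 0\<^sub>v l \<and> H = common_kernel l [a])"
  by (simp add: linear_hyperplane_def common_kernel_def)

lemma common_kernel_neq_carrier: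
  fixes a :: "'c::field Matrix.vec"
  assumes "a \<in> carrier_vec l" "a \<noteq> 0\<^sub>v l"
  shows "common_kernel l [a] \<noteq> carrier_vec l"
proof
  assume h: "common_kernel l [a] = carrier_vec l"
  have "a $ i = 0" if "i < l" for i
  proof -
    have "unit_vec l i \<in> common_kernel l [a]" unfolding h by simp
    then show ?thesis using that assms(1) by (simp add: common_kernel_def)
  qed
  then have "a = 0\<^sub>v l" using assms(1) by (intro eq_vecI) auto
  then show False using assms(2) by simp
qed

lemma linear_subspace_inter:
  assumes "\<And>H. H \<in> \<B> \<Longrightarrow> linear_subspace l H"
  shows "linear_subspace l (carrier_vec l \<inter> \<Inter>\<B>)"
proof -
  have c: "0\<^sub>v l \<in> H" "\<And>v w. v \<in> H \<Longrightarrow> w \<in> H \<Longrightarrow> v + w \<in> H" "\<And>c v. v \<in> H \<Longrightarrow> c \<cdot>\<^sub>v v \<in> H" if "H \<in> \<B>" for H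
    using assms[OF that] unfolding subspace_def submodule_def by (auto simp: module_vec_simps class_ring_simps)
  show ?thesis by (rule linear_subspaceI) (use c in auto)
qed

lemma linear_subspace_intersections_le2:
  assumes "central_arrangement l \<A>" "X \<in> intersections_le2 l \<A>"
  shows "linear_subspace l X"
proof -
  obtain \<B> where "\<B> \<subseteq> \<A>" "X = carrier_vec l \<inter> \<Inter>\<B>" using assms(2) unfolding intersections_le2_def by blast
  moreover have "linear_subspace l H" if "H \<in> \<A>" for H
    using that assms(1) linear_subspace_common_kernel[of "[_]" l]
    unfolding central_arrangement_def linear_hyperplane_iff by force
  ultimately show ?thesis using linear_subspace_inter by blast
qed

lemma card_le_2_cases:
  assumes "finite J" "card J \<le> 2"
  obtains "J = {}" | x where "J = {x}" | x y where "J = {x, y}" "x \<noteq> y"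
proof -
  have "card J = 0 \<or> card J = 1 \<or> card J = 2" using assms(2) by linarith
  then show thesis
  proof (elim disjE)
    assume "card J = 0"
    then show ?thesis using assms(1) that(1) by simp
  next
    assume "card J = 1"
    then show ?thesis by (rule card_1_singletonE) (rule that(2))
  next
    assume "card J = 2"
    then show ?thesis using that(3) by (auto simp: card_2_iff)
  qed
qed

section \<open>Ranks and small flats of a simple matroid, and their representation by
  vectors\<close>

context simple_matroid
begin

lemma indep_finite: "indep I \<Longrightarrow> finite I"
  using indep_subset_ground finite_ground finite_subset by blast

lemma finite_indep_subsets: "finite {I. I \<subseteq> X \<and> indep I}"
  by (rule finite_subset[of _ "Pow E"]) (use indep_subset_ground finite_ground in auto)

lemma card_le_rank: "I \<subseteq> X \<Longrightarrow> indep I \<Longrightarrow> card I \<le> rank X"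
  unfolding rank_def by (rule Max_ge) (use finite_indep_subsets in auto)

lemma rank_attained: "\<exists>I. I \<subseteq> X \<and> indep I \<and> card I = rank X"
proof -
  have "rank X \<in> card ` {I. I \<subseteq> X \<and> indep I}"
    unfolding rank_def by (rule Max_in) (use finite_indep_subsets indep_empty in auto)
  then show ?thesis by auto
qed

lemma rank_le: "(\<And>I. I \<subseteq> X \<Longrightarrow> indep I \<Longrightarrow> card I \<le> n) \<Longrightarrow> rank X \<le> n"
  using rank_attained[of X] by metis

lemma rank_mono: "X \<subseteq> Y \<Longrightarrow> rank X \<le> rank Y"
  by (rule rank_le) (use card_le_rank in blast)

lemma rank_empty: "rank {} = 0"
  using rank_le[of "{}" 0] by simp

lemma rank_singleton: "x \<in> E \<Longrightarrow> rank {x} = 1"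
proof -
  assume "x \<in> E"
  then have "1 \<le> rank {x}" using card_le_rank[of "{x}" "{x}"] simple[of x x] by simp
  moreover have "rank {x} \<le> 1" by (rule rank_le) (use card_mono[of "{x}"] in auto)
  ultimately show ?thesis by simp
qed

lemma rank_pair: "x \<in> E \<Longrightarrow> y \<in> E \<Longrightarrow> x \<noteq> y \<Longrightarrow> {x, y} \<subseteq> X \<Longrightarrow> 2 \<le> rank X"
  using card_le_rank[of "{x, y}" X] simple[of x y] by simp

lemma empty_in_flats_le2: "{} \<in> flats_le2"
  unfolding flats_le2_def flat_def using rank_empty rank_singleton by simp

lemma singleton_in_flats_le2:
  assumes "x \<in> E"
  shows "{x} \<in> flats_le2"
proof -
  have "rank {x} < rank (insert y {x})" if "y \<in> E - {x}" for y
    using rank_pair[of x y "insert y {x}"] rank_singleton[OF assms] assms that by auto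
  then show ?thesis
    unfolding flats_le2_def flat_def using rank_singleton[OF assms] assms by simp
qed

text \<open>A maximal set among those of rank at most 2 containing the triple is a flat, because
  enlarging it must push the rank above 2.\<close>

lemma dependent_triple_in_flat:
  assumes "x \<in> E" "y \<in> E" "z \<in> E" "\<not> indep {x, y, z}"
  shows "\<exists>F\<in>flats_le2. {x, y, z} \<subseteq> F"
proof -
  define \<F> where "\<F> = {F. F \<subseteq> E \<and> {x, y, z} \<subseteq> F \<and> rank F \<le> 2}"
  have "rank {x, y, z} \<le> 2"
  proof (rule rank_le)
    fix I assume I: "I \<subseteq> {x, y, z}" "indep I"
    then have "I \<subset> {x, y, z}" using assms(4) by blast
    then have "card I < card {x, y, z}" by (intro psubset_card_mono) auto
    moreover have "card {x, y, z} \<le> 3" by (simp add: card_insert_if)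
    ultimately show "card I \<le> 2" by simp
  qed
  then have "{x, y, z} \<in> \<F>" unfolding \<F>_def using assms by simp
  moreover have "finite \<F>" unfolding \<F>_def using finite_ground by simp
  ultimately obtain F where F: "F \<in> \<F>" "\<And>G. G \<in> \<F> \<Longrightarrow> F \<subseteq> G \<Longrightarrow> F = G"
    using finite_has_maximal2[of \<F>] by metis
  have "rank F < rank (insert e F)" if "e \<in> E - F" for e
  proof (rule ccontr)
    assume "\<not> ?thesis"
    then have "insert e F \<in> \<F>" using F(1) that unfolding \<F>_def by auto
    then have "F = insert e F" using F(2) by blast
    then show False using that by blast
  qed
  then have "flat F" using F(1) unfolding \<F>_def flat_def by simp
  then show ?thesis using F(1) unfolding \<F>_def flats_le2_def by blast
qed

text \<open>\<open>v x\<close> is thought of as a normal of the hyperplane belonging to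
  \<open>x\<close>. Once any two points extend to an independent triple, the condition on triples
  also makes the vectors nonzero and pairwise non-proportional.\<close>

definition vector_rep :: "nat \<Rightarrow> ('a \<Rightarrow> complex Matrix.vec) \<Rightarrow> bool" where
  "vector_rep l v \<longleftrightarrow> (\<forall>x\<in>E. v x \<in> carrier_vec l) \<and>
     (\<forall>x\<in>E. \<forall>y\<in>E. \<forall>z\<in>E. x \<noteq> y \<and> x \<noteq> z \<and> y \<noteq> z \<longrightarrow>
       (dep3 (coord l (v x)) (coord l (v y)) (coord l (v z)) \<longleftrightarrow> \<not> indep {x, y, z}))"

text \<open>The order reversal sends the empty flat to the whole space and points to members of the
  arrangement, whose normals are the vectors sought. A line goes to a subspace of codimension at
  most 2 inside the hyperplanes of its points, which forces dependence. Conversely, a dependence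
  puts the intersection of two of the hyperplanes inside the third, and the flat mapped to that
  intersection contains all three points.\<close>

lemma realizable_imp_vector_rep:
  assumes flats_le2_realizable
  shows "\<exists>l v. vector_rep l v"
proof -
  obtain l \<A> f where arr: "central_arrangement l \<A>"
    and bij: "bij_betw f flats_le2 (intersections_le2 l \<A>)"
    and ord': "\<forall>F\<in>flats_le2. \<forall>G\<in>flats_le2. F \<subseteq> G \<longleftrightarrow> f G \<subseteq> f F"
    using assms unfolding flats_le2_realizable_def poset_isomorphic_def by auto
  from ord' have ord: "F \<subseteq> G \<longleftrightarrow> f G \<subseteq> f F" if "F \<in> flats_le2" "G \<in> flats_le2" for F G
    using that by simp
  let ?L = "intersections_le2 l \<A>"
  have onto: "\<exists>G\<in>flats_le2. f G = X" if "X \<in> ?L" for X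
    using that unfolding bij_betw_imp_surj_on[OF bij, symmetric] by auto
  have into: "f F \<in> ?L" if "F \<in> flats_le2" for F
    by (rule bij_betw_apply[OF bij that])
  have inj: "F = G" if "F \<in> flats_le2" "G \<in> flats_le2" "f F = f G" for F G
    by (rule inj_onD[OF bij_betw_imp_inj_on[OF bij] that(3,1,2)])
  have sub: "X \<subseteq> carrier_vec l" if "X \<in> ?L" for X
    using that unfolding intersections_le2_def by blast
  have hyp: "\<exists>a\<in>carrier_vec l. a \<noteq> 0\<^sub>v l \<and> H = common_kernel l [a]" if "H \<in> \<A>" for H
    using arr that unfolding central_arrangement_def linear_hyperplane_iff by blast
  have inL: "common_kernel l as \<in> ?L"
    if "set as \<subseteq> carrier_vec l" "\<And>a. a \<in> set as \<Longrightarrow> common_kernel l [a] \<in> \<A>" "length as \<le> 2" for as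
  proof -
    have "common_kernel l as = carrier_vec l \<inter> \<Inter>((\<lambda>a. common_kernel l [a]) ` set as)"
      unfolding common_kernel_def by auto
    moreover have "(\<lambda>a. common_kernel l [a]) ` set as \<subseteq> \<A>" using that(2) by blast
    moreover have "codim l (common_kernel l as) \<le> 2" using codim_common_kernel_le[OF that(1)] that(3) by simp
    ultimately show ?thesis unfolding intersections_le2_def by blast
  qed
  have "carrier_vec l \<in> ?L" using inL[of "[]"] by (simp add: common_kernel_Nil)
  then obtain G0 where "G0 \<in> flats_le2" "f G0 = carrier_vec l" using onto by blast
  then have "carrier_vec l \<subseteq> f {}" using ord[OF empty_in_flats_le2, of G0] by simp
  then have f0: "f {} = carrier_vec l" using sub[OF into[OF empty_in_flats_le2]] by (rule antisym[rotated])
  have f1: "f {x} \<in> \<A>" if x: "x \<in> E" for x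
  proof -
    obtain \<B> where B: "\<B> \<subseteq> \<A>" "f {x} = carrier_vec l \<inter> \<Inter>\<B>"
      using into[OF singleton_in_flats_le2[OF x]] unfolding intersections_le2_def by blast
    \<comment> \<open>A proper intersection lies in one of its hyperplanes \<open>H\<close>; the
      flat mapped to \<open>H\<close> is below \<open>{x}\<close> and nonempty, hence it is
      \<open>{x}\<close>.\<close>
    have "f {x} \<noteq> carrier_vec l"
      using inj[OF singleton_in_flats_le2[OF x] empty_in_flats_le2] f0 by auto
    then obtain H where H: "H \<in> \<B>" "f {x} \<subseteq> H" "H \<in> \<A>" using B by blast
    obtain a where a: "a \<in> carrier_vec l" "a \<noteq> 0\<^sub>v l" "H = common_kernel l [a]" using hyp[OF H(3)] by blast
    have "H \<in> ?L" using inL[of "[a]"] a H(3) by simp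
    then obtain G where G: "G \<in> flats_le2" "f G = H" using onto by blast
    then have "G \<subseteq> {x}" using ord[OF G(1) singleton_in_flats_le2[OF x]] H(2) by simp
    moreover have "G \<noteq> {}" using G(2) f0 a common_kernel_neq_carrier[OF a(1,2)] by auto
    ultimately have "G = {x}" by blast
    then show ?thesis using G(2) H(3) by simp
  qed
  then have "\<exists>a. x \<in> E \<longrightarrow> a \<in> carrier_vec l \<and> a \<noteq> 0\<^sub>v l \<and> f {x} = common_kernel l [a]" for x
    using hyp by blast
  then obtain v where "\<And>x. x \<in> E \<longrightarrow> v x \<in> carrier_vec l \<and> v x \<noteq> 0\<^sub>v l \<and> f {x} = common_kernel l [v x]" by metis
  then have v: "\<And>x. x \<in> E \<Longrightarrow> v x \<in> carrier_vec l" "\<And>x. x \<in> E \<Longrightarrow> f {x} = common_kernel l [v x]" by blast+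
  have "dep3 (coord l (v x)) (coord l (v y)) (coord l (v z)) \<longleftrightarrow> \<not> indep {x, y, z}"
    if E: "x \<in> E" "y \<in> E" "z \<in> E" and ne: "x \<noteq> y" "x \<noteq> z" "y \<noteq> z" for x y z
  proof
    assume "\<not> indep {x, y, z}"
    then obtain F where F: "F \<in> flats_le2" "{x, y, z} \<subseteq> F" using dependent_triple_in_flat[OF E] by blast
    have "f F \<subseteq> common_kernel l [v u]" if "u \<in> {x, y, z}" for u
      using ord[OF singleton_in_flats_le2 F(1), of u] v(2)[of u] that E F(2) by blast
    then have "\<And>w. w \<in> f F \<Longrightarrow> v x \<bullet> w = 0 \<and> v y \<bullet> w = 0 \<and> v z \<bullet> w = 0"
      unfolding common_kernel_def by auto
    moreover have "codim l (f F) \<le> 2" using into[OF F(1)] unfolding intersections_le2_def by blast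
    ultimately show "dep3 (coord l (v x)) (coord l (v y)) (coord l (v z))"
      using codim_le2_imp_dep3 linear_subspace_intersections_le2[OF arr into[OF F(1)]] v(1) E by blast
  next
    assume "dep3 (coord l (v x)) (coord l (v y)) (coord l (v z))"
    then obtain \<alpha> \<beta> \<gamma> where nz: "\<alpha> \<noteq> 0 \<or> \<beta> \<noteq> 0 \<or> \<gamma> \<noteq> 0"
      and "\<And>i. \<alpha> * coord l (v x) i + \<beta> * coord l (v y) i + \<gamma> * coord l (v z) i = 0"
      unfolding dep3_def by blast
    then have r: "\<alpha> * (v x \<bullet> w) + \<beta> * (v y \<bullet> w) + \<gamma> * (v z \<bullet> w) = 0" if "w \<in> carrier_vec l" for w
      using lincomb_scalar_prod v(1) E that by blast
    \<comment> \<open>Hyperplanes of distinct points are incomparable, which excludes a relation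
      with \<open>\<gamma> = 0\<close>.\<close>
    have neq: "\<not> common_kernel l [v a] \<subseteq> common_kernel l [v b]" if "a \<in> E" "b \<in> E" "a \<noteq> b" for a b
      using ord[OF singleton_in_flats_le2[OF that(2)] singleton_in_flats_le2[OF that(1)]] v(2) that by auto
    have "\<gamma> \<noteq> 0"
    proof
      assume "\<gamma> = 0"
      then have r': "\<alpha> * (v x \<bullet> w) + \<beta> * (v y \<bullet> w) = 0" if "w \<in> carrier_vec l" for w using r[OF that] by simp
      have "\<alpha> = 0" using neq[OF E(2,1)] ne r' unfolding common_kernel_def by fastforce
      moreover have "\<beta> = 0" using neq[OF E(1,2)] ne r' unfolding common_kernel_def by fastforce
      ultimately show False using nz \<open>\<gamma> = 0\<close> by blast
    qed
    let ?X = "common_kernel l [v x, v y]"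
    have Xz: "?X \<subseteq> common_kernel l [v z]" using r \<open>\<gamma> \<noteq> 0\<close> unfolding common_kernel_def by fastforce
    have "?X \<in> ?L" using inL[of "[v x, v y]"] v E f1 by fastforce
    then obtain F where F: "F \<in> flats_le2" "f F = ?X" using onto by blast
    have "u \<in> F" if "u \<in> {x, y, z}" for u
    proof -
      have "u \<in> E" using that E by blast
      moreover have "f F \<subseteq> f {u}"
        using that Xz unfolding F(2) v(2)[OF \<open>u \<in> E\<close>] unfolding common_kernel_def by auto
      ultimately show ?thesis using ord[OF singleton_in_flats_le2 F(1)] by blast
    qed
    then have "{x, y, z} \<subseteq> F" by blast
    moreover have "card {x, y, z} = 3" using ne by simp
    moreover have "rank F \<le> 2" using F(1) unfolding flats_le2_def by blast
    ultimately show "\<not> indep {x, y, z}" using card_le_rank[of "{x, y, z}" F] by fastforce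
  qed
  then show ?thesis unfolding vector_rep_def using v(1) by blast
qed

text \<open>A flat is sent to the intersection of the hyperplanes of its points. Through
  \<open>third\<close> and \<open>second\<close> every point and every pair can be completed to an
  independent triple; the dual vectors of such triples separate the images of different
  flats.\<close>

lemma vector_rep_imp_realizable:
  assumes rep: "vector_rep l v"
    and third: "\<And>x y. x \<in> E \<Longrightarrow> y \<in> E \<Longrightarrow> x \<noteq> y \<Longrightarrow> \<exists>z\<in>E. z \<noteq> x \<and> z \<noteq> y \<and> indep {x, y, z}"
    and second: "\<And>x. x \<in> E \<Longrightarrow> \<exists>y\<in>E. y \<noteq> x"
  shows flats_le2_realizable
proof -
  have v: "\<And>x. x \<in> E \<Longrightarrow> v x \<in> carrier_vec l"
    and dep: "\<And>x y z. x \<in> E \<Longrightarrow> y \<in> E \<Longrightarrow> z \<in> E \<Longrightarrow> x \<noteq> y \<Longrightarrow> x \<noteq> z \<Longrightarrow> y \<noteq> z \<Longrightarrow>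
      dep3 (coord l (v x)) (coord l (v y)) (coord l (v z)) \<longleftrightarrow> \<not> indep {x, y, z}"
    using rep unfolding vector_rep_def by blast+
  define ker where "ker x = common_kernel l [v x]" for x
  define f where "f F = carrier_vec l \<inter> \<Inter>(ker ` F)" for F
  define \<A> where "\<A> = ker ` E"
  have f_ker: "f F \<subseteq> ker x" if "x \<in> F" for F x using that unfolding f_def by auto
  have dual: "\<exists>w\<in>carrier_vec l. v x \<bullet> w = 0 \<and> v y \<bullet> w = 0 \<and> v z \<bullet> w = 1"
    if "indep {x, y, z}" "x \<noteq> y" "x \<noteq> z" "y \<noteq> z" for x y z
  proof -
    have "x \<in> E" "y \<in> E" "z \<in> E" using indep_subset_ground[OF that(1)] by auto
    then show ?thesis using dual_vector[of "v x" l "v y" "v z"] dep that v by metis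
  qed
  \<comment> \<open>\<open>J\<close> is padded to two points that form an independent triple with
    \<open>e\<close>; the vector dual to \<open>e\<close> in this triple lies in \<open>f J\<close>
    but not in \<open>ker e\<close>.\<close>
  have sep: "\<not> f J \<subseteq> ker e" if "indep (insert e J)" "e \<notin> J" "card J \<le> 2" for e J
  proof -
    have J: "finite J" "J \<subseteq> E" "e \<in> E"
      using indep_finite[OF that(1)] indep_subset_ground[OF that(1)] by auto
    have "\<exists>x y. J \<subseteq> {x, y} \<and> x \<noteq> y \<and> x \<noteq> e \<and> y \<noteq> e \<and> indep {x, y, e}"
    proof -
      show ?thesis
      proof (rule card_le_2_cases[OF J(1) that(3)])
        assume "J = {}"
        moreover obtain x where "x \<in> E" "x \<noteq> e" using second[OF J(3)] by blast
        moreover from this obtain y where "y \<noteq> e" "y \<noteq> x" "indep {e, x, y}" using third[OF J(3)] by metis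
        ultimately show ?thesis by (intro exI[of _ x] exI[of _ y]) (auto simp: insert_commute)
      next
        fix x assume x: "J = {x}"
        then have "x \<in> E" "e \<noteq> x" using J(2) that(2) by auto
        then obtain y where "y \<noteq> e" "y \<noteq> x" "indep {e, x, y}" using third[OF J(3)] by metis
        then show ?thesis using x \<open>e \<noteq> x\<close> by (intro exI[of _ x] exI[of _ y]) (auto simp: insert_commute)
      next
        fix x y assume "J = {x, y}" "x \<noteq> y"
        then show ?thesis using that(1,2) by (intro exI[of _ x] exI[of _ y]) (auto simp: insert_commute)
      qed
    qed
    then obtain x y where xy: "J \<subseteq> {x, y}" "x \<noteq> y" "x \<noteq> e" "y \<noteq> e" "indep {x, y, e}" by blast
    then obtain w where "w \<in> carrier_vec l" "v x \<bullet> w = 0" "v y \<bullet> w = 0" "v e \<bullet> w = 1" using dual by blast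
    then have "w \<in> f J" "w \<notin> ker e" using xy(1) unfolding f_def ker_def common_kernel_def by auto
    then show ?thesis by blast
  qed
  have line: "ker x \<inter> ker y \<subseteq> ker z"
    if E: "x \<in> E" "y \<in> E" "z \<in> E" and ne: "x \<noteq> y" and ni: "\<not> indep {x, y, z}" for x y z
  proof (cases "z = x \<or> z = y")
    case False
    then obtain \<alpha> \<beta> \<gamma> where nz: "\<alpha> \<noteq> 0 \<or> \<beta> \<noteq> 0 \<or> \<gamma> \<noteq> 0"
      and r: "\<And>i. \<alpha> * coord l (v x) i + \<beta> * coord l (v y) i + \<gamma> * coord l (v z) i = 0"
      using dep[OF E] ne ni unfolding dep3_def by blast
    obtain u where "u \<in> E" "u \<noteq> x" "u \<noteq> y" "indep {x, y, u}" using third[OF E(1,2) ne] by blast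
    then have nd: "\<not> dep3 (coord l (v x)) (coord l (v y)) (coord l (v u))" using dep E ne by blast
    have "\<gamma> \<noteq> 0"
    proof
      assume "\<gamma> = 0"
      then have "\<alpha> * coord l (v x) i + \<beta> * coord l (v y) i + 0 * coord l (v u) i = 0" for i using r[of i] by simp
      from indep3D[OF nd this] show False using nz \<open>\<gamma> = 0\<close> by blast
    qed
    moreover have "\<alpha> * (v x \<bullet> w) + \<beta> * (v y \<bullet> w) + \<gamma> * (v z \<bullet> w) = 0" if "w \<in> carrier_vec l" for w
      using lincomb_scalar_prod[OF v[OF E(1)] v[OF E(2)] v[OF E(3)] that r] .
    ultimately show ?thesis unfolding ker_def common_kernel_def by fastforce
  qed auto
  \<comment> \<open>A point of \<open>F\<close> outside a basis \<open>J\<close> is dependent on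
    \<open>J\<close>; simplicity excludes bases with fewer than two points, so \<open>line\<close>
    applies to a pair.\<close>
  have basis: "\<exists>J\<subseteq>F. indep J \<and> card J = rank F \<and> f J \<subseteq> f F"
    if F: "F \<subseteq> E" "rank F \<le> 2" for F
  proof -
    obtain J where J: "J \<subseteq> F" "indep J" "card J = rank F" using rank_attained by blast
    have "f J \<subseteq> ker z" if "z \<in> F" for z
    proof (cases "z \<in> J")
      case False
      have "\<not> indep (insert z J)"
      proof
        assume "indep (insert z J)"
        then have "card (insert z J) \<le> rank F" using card_le_rank[of "insert z J" F] J(1) that by simp
        then show False using False J(3) indep_finite[OF J(2)] by simp
      qed
      moreover have "indep {z}" "\<And>x. x \<in> J \<Longrightarrow> indep {z, x}" using simple[of z z] simple[of z] J(1) F that by auto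
      moreover have "card J \<le> 2" using J(3) F(2) by simp
      ultimately obtain x y where "J = {x, y}" "x \<noteq> y"
        by (rule_tac card_le_2_cases[OF indep_finite[OF J(2)]]) auto
      moreover from this have "\<not> indep {x, y, z}" using \<open>\<not> indep (insert z J)\<close> by (simp add: insert_commute)
      ultimately show ?thesis using line[of x y z] J(1) F(1) that unfolding f_def by auto
    qed (auto simp: f_def)
    then have "f J \<subseteq> f F" unfolding f_def by blast
    then show ?thesis using J by blast
  qed
  have codim: "codim l (f F) \<le> 2" if F: "F \<subseteq> E" "rank F \<le> 2" for F
  proof -
    obtain J where J: "J \<subseteq> F" "indep J" "card J = rank F" "f J \<subseteq> f F" using basis[OF F] by blast
    have "f F = f J" using J(1,4) unfolding f_def by blast
    obtain xs where xs: "set xs = J" "length xs = card J" using finite_distinct_list[OF indep_finite[OF J(2)]] distinct_card by metis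
    have "f J = common_kernel l (map v xs)" unfolding f_def ker_def common_kernel_def xs(1)[symmetric] by auto
    moreover have "set (map v xs) \<subseteq> carrier_vec l" using xs(1) v J(1) F(1) by auto
    ultimately show ?thesis using codim_common_kernel_le[of "map v xs" l] xs(2) J(3) F(2) \<open>f F = f J\<close> by simp
  qed
  have arr: "central_arrangement l \<A>"
  proof -
    have "v x \<noteq> 0\<^sub>v l" if "x \<in> E" for x
    proof
      assume "v x = 0\<^sub>v l"
      then have "ker x = carrier_vec l" unfolding ker_def common_kernel_def by auto
      then have "f {} \<subseteq> ker x" unfolding f_def by simp
      then show False using sep[of x "{}"] simple[OF that that] by simp
    qed
    then have "linear_hyperplane l (ker x)" if "x \<in> E" for x
      unfolding linear_hyperplane_iff ker_def using v that by blast
    then show ?thesis unfolding central_arrangement_def \<A>_def using finite_ground by blast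
  qed
  \<comment> \<open>A point \<open>e\<close> of \<open>F\<close> outside the flat \<open>G\<close>
    is independent of a basis of \<open>G\<close> by augmentation, and then \<open>sep\<close>
    contradicts the inclusion of the images.\<close>
  have order: "F \<subseteq> G" if F: "F \<in> flats_le2" and G: "G \<in> flats_le2" and le: "f G \<subseteq> f F" for F G
  proof (rule ccontr)
    assume "\<not> F \<subseteq> G"
    then obtain e where e: "e \<in> F" "e \<notin> G" by blast
    have FG: "F \<subseteq> E" "G \<subseteq> E" "rank G \<le> 2" using F G unfolding flats_le2_def flat_def by blast+
    obtain J where J: "J \<subseteq> G" "indep J" "card J = rank G" "f J \<subseteq> f G" using basis[OF FG(2,3)] by blast
    have "rank G < rank (insert e G)" using G e FG unfolding flats_le2_def flat_def by blast
    then obtain I where I: "I \<subseteq> insert e G" "indep I" "card J < card I" using rank_attained J(3) by metis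
    obtain y where y: "y \<in> I - J" "indep (insert y J)" using augment[OF J(2) I(2,3)] by blast
    have "y = e"
    proof (rule ccontr)
      assume "y \<noteq> e"
      then have "insert y J \<subseteq> G" using y I J by blast
      then have "card (insert y J) \<le> rank G" using y card_le_rank by blast
      then show False using y J(3) indep_finite[OF J(2)] by simp
    qed
    moreover have "f J \<subseteq> ker e" by (rule order_trans[OF J(4) order_trans[OF le f_ker[OF e(1)]]])
    ultimately show False using sep[of e J] y J(1,3) FG(3) e(2) by auto
  qed
  have into: "f F \<in> intersections_le2 l \<A>" if "F \<in> flats_le2" for F
  proof -
    have F: "F \<subseteq> E" "rank F \<le> 2" using that unfolding flats_le2_def flat_def by blast+
    then have "ker ` F \<subseteq> \<A>" unfolding \<A>_def by blast
    then show ?thesis using codim[OF F] unfolding intersections_le2_def f_def by blast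
  qed
  have onto: "\<exists>F\<in>flats_le2. f F = X" if X: "X \<in> intersections_le2 l \<A>" for X
  proof -
    obtain \<B> where B: "\<B> \<subseteq> \<A>" "X = carrier_vec l \<inter> \<Inter>\<B>" "codim l X \<le> 2"
      using X unfolding intersections_le2_def by blast
    \<comment> \<open>The largest possible preimage: all points whose hyperplane contains
      \<open>X\<close>. Three independent points in it would give three independent normals
      vanishing on \<open>X\<close>, too many for codimension 2.\<close>
    define F where "F = {x \<in> E. X \<subseteq> ker x}"
    have F: "F \<subseteq> E" unfolding F_def by blast
    have "\<B> \<subseteq> ker ` F" using B(1,2) unfolding F_def \<A>_def by blast
    moreover have "X \<subseteq> f F" using B(2) unfolding f_def F_def by blast
    ultimately have XF: "f F = X" using B(2) unfolding f_def by blast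
    have lin: "linear_subspace l X" by (rule linear_subspace_intersections_le2[OF arr X])
    have rank: "rank F \<le> 2"
    proof (rule rank_le, rule ccontr)
      fix I assume I: "I \<subseteq> F" "indep I" "\<not> card I \<le> 2"
      then obtain T where T: "T \<subseteq> I" "card T = 3" using obtain_subset_with_card_n[of 3 I] by force
      then obtain x y z where xyz: "T = {x, y, z}" "x \<noteq> y" "x \<noteq> z" "y \<noteq> z" using card_3_iff by metis
      have xF: "x \<in> F" "y \<in> F" "z \<in> F" using xyz(1) T(1) I(1) by auto
      then have E: "x \<in> E" "y \<in> E" "z \<in> E" using F by auto
      have "v x \<bullet> w = 0 \<and> v y \<bullet> w = 0 \<and> v z \<bullet> w = 0" if "w \<in> X" for w
        using xF that unfolding F_def ker_def common_kernel_def by auto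
      then have "dep3 (coord l (v x)) (coord l (v y)) (coord l (v z))"
        using codim_le2_imp_dep3[OF lin B(3)] v E by blast
      then have "\<not> indep T" using dep[OF E xyz(2-4)] xyz(1) by simp
      then show False using indep_mono[OF I(2) T(1)] by blast
    qed
    have "rank F < rank (insert e F)" if e: "e \<in> E - F" for e
    proof (rule ccontr)
      assume "\<not> ?thesis"
      then have le: "rank (insert e F) \<le> rank F" by simp
      moreover have "rank F \<le> rank (insert e F)" by (rule rank_mono) blast
      ultimately have "rank (insert e F) \<le> 2" "insert e F \<subseteq> E" using rank e F by auto
      then obtain J where J: "J \<subseteq> F" "indep J" "card J = rank F" "f J \<subseteq> f F" using basis[OF F rank] by blast
      have "f J \<subseteq> ker e"
      proof -
        have "\<not> indep (insert e J)"
        proof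
          assume "indep (insert e J)"
          then have "card (insert e J) \<le> rank F"
            using order_trans[OF card_le_rank[OF insert_mono[OF J(1)]] le] by blast
          moreover have "e \<notin> J" using e J(1) by blast
          ultimately show False using J(3) indep_finite[OF J(2)] by simp
        qed
        moreover have "indep {e}" "\<And>x. x \<in> J \<Longrightarrow> indep {e, x}" using simple[of e e] simple[of e] J(1) F e by auto
        moreover have "card J \<le> 2" using J(3) rank by simp
        ultimately obtain x y where "J = {x, y}" "x \<noteq> y"
          by (rule_tac card_le_2_cases[OF indep_finite[OF J(2)]]) auto
        moreover from this have "\<not> indep {x, y, e}" using \<open>\<not> indep (insert e J)\<close> by (simp add: insert_commute)
        ultimately show ?thesis using line[of x y e] J(1) F e unfolding f_def by auto
      qed
      moreover have "X \<subseteq> f J" using XF J(1) unfolding f_def by blast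
      ultimately show False using e unfolding F_def by blast
    qed
    then have "F \<in> flats_le2" using F rank unfolding flats_le2_def flat_def by blast
    then show ?thesis using XF by blast
  qed
  have anti: "f G \<subseteq> f F" if "F \<subseteq> G" for F G using that unfolding f_def by blast
  have "bij_betw f flats_le2 (intersections_le2 l \<A>)"
    unfolding bij_betw_def
  proof
    show "inj_on f flats_le2"
    proof (rule inj_onI)
      fix F G assume "F \<in> flats_le2" "G \<in> flats_le2" "f F = f G"
      then show "F = G" using order[of F G] order[of G F] by simp
    qed
    show "f ` flats_le2 = intersections_le2 l \<A>" using into onto by (force simp: image_iff)
  qed
  moreover have "\<forall>F\<in>flats_le2. \<forall>G\<in>flats_le2. F \<subseteq> G \<longleftrightarrow> f G \<subseteq> f F"
    using order anti by metis
  ultimately have "poset_isomorphic flats_le2 (\<subseteq>) (intersections_le2 l \<A>) (\<supseteq>)"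
    unfolding poset_isomorphic_def by (intro exI[of _ f] conjI)
  then show ?thesis
    unfolding flats_le2_realizable_def using arr by metis
qed

end

section \<open>The affine plane over a field with at least four elements\<close>

definition span2 :: "('i \<Rightarrow> 'c::field) \<Rightarrow> ('i \<Rightarrow> 'c) \<Rightarrow> ('i \<Rightarrow> 'c) \<Rightarrow> bool" where
  "span2 u v w \<longleftrightarrow> (\<exists>\<alpha> \<beta>. \<forall>i. w i = \<alpha> * u i + \<beta> * v i)"

lemma span2_lincomb:
  assumes "span2 u v w" "span2 u v w'"
  shows "span2 u v (\<lambda>i. a * w i + b * w' i)"
proof -
  obtain \<alpha> \<beta> \<alpha>' \<beta>' where "\<And>i. w i = \<alpha> * u i + \<beta> * v i" "\<And>i. w' i = \<alpha>' * u i + \<beta>' * v i"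
    using assms unfolding span2_def by blast
  then have "a * w i + b * w' i = (a * \<alpha> + b * \<alpha>') * u i + (a * \<beta> + b * \<beta>') * v i" for i
    by (simp add: algebra_simps)
  then show ?thesis unfolding span2_def by blast
qed

lemma span2_scale:
  assumes "span2 u v w"
  shows "span2 u v (\<lambda>i. a * w i)"
  using span2_lincomb[OF assms assms, of a 0] by simp

lemma span2_imp_dep3:
  assumes "span2 u v (\<lambda>i. c * w i)" "c \<noteq> 0"
  shows "dep3 u v w"
proof -
  obtain \<alpha> \<beta> where "\<And>i. c * w i = \<alpha> * u i + \<beta> * v i" using assms(1) unfolding span2_def by blast
  then have "\<alpha> * u i + \<beta> * v i + (- c) * w i = 0" for i by simp
  moreover have "- c \<noteq> 0" using assms(2) by simp
  ultimately show ?thesis unfolding dep3_def by blast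
qed

text \<open>The vector \<open>z\<close> certifies that \<open>u\<close> and \<open>v\<close> are
  independent, so \<open>w\<close> has a nonzero coefficient in the relation.\<close>

lemma dep3_imp_span2:
  assumes "dep3 u v w" "\<not> dep3 u v z"
  shows "span2 u v w"
proof -
  obtain \<alpha> \<beta> \<gamma> where nz: "\<alpha> \<noteq> 0 \<or> \<beta> \<noteq> 0 \<or> \<gamma> \<noteq> 0" and r: "\<And>i. \<alpha> * u i + \<beta> * v i + \<gamma> * w i = 0"
    using assms(1) unfolding dep3_def by blast
  have "\<gamma> \<noteq> 0"
  proof
    assume "\<gamma> = 0"
    then have "\<alpha> * u i + \<beta> * v i + 0 * z i = 0" for i using r[of i] by simp
    then show False using indep3D[OF assms(2)] nz \<open>\<gamma> = 0\<close> by blast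
  qed
  have "w i = (- \<alpha> / \<gamma>) * u i + (- \<beta> / \<gamma>) * v i" for i
  proof -
    have "\<gamma> * w i = - \<alpha> * u i - \<beta> * v i" using r[of i] by (simp add: eq_neg_iff_add_eq_0 algebra_simps)
    then have "w i = (- \<alpha> * u i - \<beta> * v i) / \<gamma>" using \<open>\<gamma> \<noteq> 0\<close> by (simp add: eq_divide_eq mult.commute)
    then show ?thesis by (simp add: diff_divide_distrib)
  qed
  then show ?thesis unfolding span2_def by blast
qed

lemma span2_eq: "span2 u v w \<longleftrightarrow> (\<exists>\<alpha> \<beta>. w = (\<lambda>i. \<alpha> * u i + \<beta> * v i))"
  unfolding span2_def fun_eq_iff ..

text \<open>Two expressions for \<open>R\<close> give a vector common to the lines \<open>BC\<close>
  and \<open>B'C'\<close>. Comparing coefficients in the independent triples \<open>P, B, B'\<close>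
  and \<open>Q, C, C'\<close> yields \<open>\<alpha> * y = \<beta>\<close> and
  \<open>\<alpha> * w = \<gamma>\<close>; the two expressions for \<open>A\<close> then place the
  same vector on \<open>PQ\<close>.\<close>

lemma desargues:
  assumes A: "A = (\<lambda>i. x * P i + y * B i)" "A = (\<lambda>i. z * Q i + w * C i)"
    and A': "A' = (\<lambda>i. x' * P i + y' * B' i)" "A' = (\<lambda>i. z' * Q i + w' * C' i)"
    and R: "R = (\<lambda>i. \<alpha> * A i + \<alpha>' * A' i)" "R = (\<lambda>i. \<beta> * B i + \<beta>' * B' i)"
      "R = (\<lambda>i. \<gamma> * C i + \<gamma>' * C' i)"
    and indep: "\<not> dep3 P B B'" "\<not> dep3 Q C C'"
  shows "(\<lambda>i. \<gamma> * C i + (- \<beta>) * B i) = (\<lambda>i. \<beta>' * B' i + (- \<gamma>') * C' i)"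
    and "(\<lambda>i. \<gamma> * C i + (- \<beta>) * B i) = (\<lambda>i. (\<alpha> * x) * P i + (- (\<alpha> * z)) * Q i)"
proof -
  note A = A[THEN fun_cong] and A' = A'[THEN fun_cong] and R = R[THEN fun_cong]
  have "(\<alpha> * x + \<alpha>' * x') * P i + (\<alpha> * y - \<beta>) * B i + (\<alpha>' * y' - \<beta>') * B' i = 0" for i
    using R(1)[of i] R(2)[of i] unfolding A(1) A'(1) by (simp add: algebra_simps)
  then have \<beta>: "\<alpha> * y = \<beta>" using indep3D(2)[OF indep(1)] by fastforce
  have "(\<alpha> * z + \<alpha>' * z') * Q i + (\<alpha> * w - \<gamma>) * C i + (\<alpha>' * w' - \<gamma>') * C' i = 0" for i
    using R(1)[of i] R(3)[of i] unfolding A(2) A'(2) by (simp add: algebra_simps)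
  then have \<gamma>: "\<alpha> * w = \<gamma>" using indep3D(2)[OF indep(2)] by fastforce
  have "\<gamma> * C i + (- \<beta>) * B i = \<beta>' * B' i + (- \<gamma>') * C' i" for i
    using R(2)[of i] R(3)[of i] by (simp add: algebra_simps)
  then show "(\<lambda>i. \<gamma> * C i + (- \<beta>) * B i) = (\<lambda>i. \<beta>' * B' i + (- \<gamma>') * C' i)" by blast
  have "\<alpha> * (x * P i + y * B i) = \<alpha> * (z * Q i + w * C i)" for i using A(1)[of i] A(2)[of i] by simp
  then have "\<gamma> * C i + (- \<beta>) * B i = (\<alpha> * x) * P i + (- (\<alpha> * z)) * Q i" for i
    unfolding \<beta>[symmetric] \<gamma>[symmetric] by (simp add: algebra_simps)
  then show "(\<lambda>i. \<gamma> * C i + (- \<beta>) * B i) = (\<lambda>i. (\<alpha> * x) * P i + (- (\<alpha> * z)) * Q i)" by blast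
qed

text \<open>\<open>V x y\<close> represents the point (x, y). The equation says that the differences
  to the first point are parallel, and it also covers coinciding points.\<close>

locale affine_plane_rep =
  fixes V :: "'k::field \<Rightarrow> 'k \<Rightarrow> 'i \<Rightarrow> 'c::field"
  assumes dep: "dep3 (V x1 y1) (V x2 y2) (V x3 y3) \<longleftrightarrow> (x2 - x1) * (y3 - y1) = (x3 - x1) * (y2 - y1)"
begin

lemma transpose: "affine_plane_rep (\<lambda>x y. V y x)"
  by unfold_locales (simp only: dep mult.commute eq_commute)

lemma indep2:
  assumes "(x1, y1) \<noteq> (x2, y2)"
  obtains x3 y3 where "\<not> dep3 (V x1 y1) (V x2 y2) (V x3 y3)"
proof (cases "x1 = x2")
  case True
  then have "\<not> dep3 (V x1 y1) (V x2 y2) (V (x1 + 1) y1)" using assms by (simp add: dep)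
  then show ?thesis by (rule that)
next
  case False
  then have "\<not> dep3 (V x1 y1) (V x2 y2) (V x1 (y1 + 1))" by (simp add: dep)
  then show ?thesis by (rule that)
qed

lemma span2_line:
  assumes "(x1, y1) \<noteq> (x2, y2)" "(x2 - x1) * (y3 - y1) = (x3 - x1) * (y2 - y1)"
  shows "span2 (V x1 y1) (V x2 y2) (V x3 y3)"
  using indep2[OF assms(1)] dep3_imp_span2 assms(2) dep by metis

lemma indep2D:
  assumes "(x1, y1) \<noteq> (x2, y2)" "\<And>i. \<alpha> * V x1 y1 i + \<beta> * V x2 y2 i = 0"
  shows "\<alpha> = 0" "\<beta> = 0"
proof -
  obtain x3 y3 where n: "\<not> dep3 (V x1 y1) (V x2 y2) (V x3 y3)" using indep2[OF assms(1)] .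
  have "\<alpha> * V x1 y1 i + \<beta> * V x2 y2 i + 0 * V x3 y3 i = 0" for i using assms(2) by simp
  then show "\<alpha> = 0" "\<beta> = 0" using indep3D[OF n] by blast+
qed

lemma not_in_line:
  assumes "span2 (V x1 y1) (V x2 y2) (\<lambda>i. c * V x3 y3 i)" "(x2 - x1) * (y3 - y1) \<noteq> (x3 - x1) * (y2 - y1)"
  shows "c = 0"
  using span2_imp_dep3[OF assms(1)] assms(2) dep by blast

section \<open>Concurrence of the lines representing a parallel class\<close>

abbreviation row :: "'k \<Rightarrow> ('i \<Rightarrow> 'c) \<Rightarrow> bool" where
  "row t w \<equiv> span2 (V 0 t) (V 1 t) w"

lemma row_point: "row t (V x t)"
  by (rule span2_line) simp_all

text \<open>Desargues' theorem is applied to triangles \<open>A B C\<close> and \<open>A' B' C'\<close> in perspective from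
  \<open>R\<close>, where \<open>B C\<close>, \<open>B' C'\<close> and the axis \<open>P Q\<close> are the three rows. The differences \<open>1\<close>, \<open>r\<close>, \<open>s\<close> of the
  pairs on the rows must be distinct and nonzero for \<open>R\<close>, \<open>A\<close>, \<open>A'\<close> to exist, so the argument needs four
  field elements.\<close>

lemma three_rows_concurrent:
  fixes r s t :: 'k
  assumes rs: "r \<noteq> 0" "r \<noteq> 1" "s \<noteq> 0" "s \<noteq> 1" "r \<noteq> s" and t: "t \<noteq> 0" "t \<noteq> 1"
  shows "\<exists>w. (\<exists>i. w i \<noteq> 0) \<and> row 0 w \<and> row 1 w \<and> row t w"
proof -
  \<comment> \<open>\<open>e\<close> will be the abscissa of \<open>P\<close>. The two excluded
    values are those with \<open>P\<close> on the line \<open>BB'\<close> or \<open>Q\<close> on the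
    line \<open>CC'\<close>, where \<open>desargues\<close> would lack its independent
    triples.\<close>
  have "\<exists>e. e \<noteq> 0 \<and> e \<noteq> 1 - s + t * (r - 1)"
  proof (cases "1 = 1 - s + t * (r - 1)")
    case True
    then show ?thesis using rs by (intro exI[of _ r]) auto
  qed (auto intro: exI[of _ 1])
  then obtain e where e: "e \<noteq> 0" "e \<noteq> 1 - s + t * (r - 1)" by blast
  have nz: "1 - r \<noteq> 0" "1 - s \<noteq> 0" "r - s \<noteq> 0" using rs by auto
  let ?B = "V 0 0" and ?C = "V 1 0" and ?B' = "V 0 1" and ?C' = "V r 1" and ?P = "V e t" and ?Q = "V (e + s) t"
  \<comment> \<open>\<open>R\<close> is the meet of \<open>BB'\<close> and \<open>CC'\<close>,
    \<open>A\<close> that of \<open>PB\<close> and \<open>QC\<close>, \<open>A'\<close> that of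
    \<open>PB'\<close> and \<open>QC'\<close>; the denominators are the differences between 1,
    \<open>r\<close> and \<open>s\<close>.\<close>
  let ?R = "V 0 (1 / (1 - r))" and ?A = "V (e / (1 - s)) (t / (1 - s))"
  let ?A' = "V (e * r / (r - s)) (1 + (t - 1) * r / (r - s))"
  have "span2 ?P ?B ?A" by (rule span2_line) (use t nz in \<open>simp_all add: field_simps\<close>)
  moreover have "span2 ?Q ?C ?A" by (rule span2_line) (use t nz in \<open>simp_all add: field_simps\<close>)
  moreover have "span2 ?P ?B' ?A'" by (rule span2_line) (use t nz in \<open>simp_all add: field_simps\<close>)
  moreover have "span2 ?Q ?C' ?A'" by (rule span2_line) (use t nz in \<open>simp_all add: field_simps\<close>)
  \<comment> \<open>This is the converse of Desargues' theorem in the plane over \<open>'k\<close>: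
    the axis is the row of \<open>P\<close> and \<open>Q\<close>, which the rows \<open>BC\<close>
    and \<open>B'C'\<close> meet at infinity. It comes down to a rational identity in
    \<open>r\<close> and \<open>s\<close>.\<close>
  moreover have "span2 ?A ?A' ?R"
  proof (rule span2_line)
    show "(e / (1 - s), t / (1 - s)) \<noteq> (e * r / (r - s), 1 + (t - 1) * r / (r - s))"
      using nz e(1) rs by (auto simp: field_simps)
    define a b c where abc: "a = 1 / (1 - s)" "b = r / (r - s)" "c = 1 / (1 - r)"
    have "b * c - a * c = - a + a * b" unfolding abc using nz by (simp add: divide_simps) (simp add: algebra_simps)
    moreover have "(e * b - e * a) * (c - t * a) - (0 - e * a) * (1 + (t - 1) * b - t * a)
        = e * ((b * c - a * c) - (- a + a * b))" by (simp add: algebra_simps)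
    ultimately have "(e * b - e * a) * (c - t * a) - (0 - e * a) * (1 + (t - 1) * b - t * a) = e * 0"
      by (simp only: diff_self)
    then have "(e * b - e * a) * (c - t * a) = (0 - e * a) * (1 + (t - 1) * b - t * a)"
      by (simp only: mult_zero_right right_minus_eq)
    then show "(e * r / (r - s) - e / (1 - s)) * (1 / (1 - r) - t / (1 - s))
        = (0 - e / (1 - s)) * (1 + (t - 1) * r / (r - s) - t / (1 - s))"
      unfolding abc by (simp only: times_divide_eq_right mult_1_right)
  qed
  moreover have "span2 ?B ?B' ?R" by (rule span2_line) simp_all
  moreover have "span2 ?C ?C' ?R" by (rule span2_line) (use nz in \<open>simp_all add: field_simps\<close>)
  ultimately obtain x y z w x' y' z' w' \<alpha> \<alpha>' \<beta> \<beta>' \<gamma> \<gamma>' where eqs: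
    "?A = (\<lambda>i. x * ?P i + y * ?B i)" "?A = (\<lambda>i. z * ?Q i + w * ?C i)"
    "?A' = (\<lambda>i. x' * ?P i + y' * ?B' i)" "?A' = (\<lambda>i. z' * ?Q i + w' * ?C' i)"
    "?R = (\<lambda>i. \<alpha> * ?A i + \<alpha>' * ?A' i)" "?R = (\<lambda>i. \<beta> * ?B i + \<beta>' * ?B' i)"
    "?R = (\<lambda>i. \<gamma> * ?C i + \<gamma>' * ?C' i)"
    unfolding span2_eq by blast
  have "\<not> dep3 ?P ?B ?B'" using e(1) by (simp add: dep algebra_simps)
  moreover have "\<not> dep3 ?Q ?C ?C'" using e(2) by (simp add: dep algebra_simps)
  ultimately have D: "(\<lambda>i. \<gamma> * ?C i + (- \<beta>) * ?B i) = (\<lambda>i. \<beta>' * ?B' i + (- \<gamma>') * ?C' i)"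
      "(\<lambda>i. \<gamma> * ?C i + (- \<beta>) * ?B i) = (\<lambda>i. (\<alpha> * x) * ?P i + (- (\<alpha> * z)) * ?Q i)"
    by (rule desargues[OF eqs])+
  let ?w = "\<lambda>i. \<gamma> * ?C i + (- \<beta>) * ?B i"
  \<comment> \<open>Otherwise the vectors of \<open>R\<close> and \<open>B'\<close> would be
    proportional, although these are different points because \<open>r\<close> is nonzero.\<close>
  have "\<beta> \<noteq> 0"
  proof
    assume "\<beta> = 0"
    then have "1 * ?R i + (- \<beta>') * ?B' i = 0" for i using fun_cong[OF eqs(6), of i] by simp
    moreover have "(0, 1 / (1 - r)) \<noteq> (0, 1)" using nz rs(1) by (simp add: field_simps)
    ultimately show False using indep2D(1) by (metis one_neq_zero)
  qed
  have "\<exists>i. ?w i \<noteq> 0"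
  proof (rule ccontr)
    assume "\<not> ?thesis"
    then have "\<gamma> * ?C i + (- \<beta>) * ?B i = 0" for i by blast
    then have "- \<beta> = 0" by (rule indep2D(2)[rotated]) simp
    then show False using \<open>\<beta> \<noteq> 0\<close> by simp
  qed
  moreover have "row 0 ?w" by (rule span2_lincomb[OF row_point row_point])
  moreover have "row 1 ?w" unfolding D(1) by (rule span2_lincomb[OF row_point row_point])
  moreover have "row t ?w" unfolding D(2) by (rule span2_lincomb[OF row_point row_point])
  ultimately show ?thesis by (intro exI[of _ ?w] conjI)
qed

text \<open>Rows 0 and 1 span different planes, which share at most one direction. Hence the vectors
  found for the various \<open>t\<close> in \<open>three_rows_concurrent\<close> are all
  proportional.\<close>

lemma rows_0_1_meet:
  assumes "\<exists>i. w i \<noteq> 0" "row 0 w" "row 1 w" "row 0 w'" "row 1 w'"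
  shows "\<exists>c. \<forall>i. w' i = c * w i"
proof -
  obtain \<alpha> \<beta> \<alpha>' \<beta>' where w: "\<And>i. w i = \<alpha> * V 0 0 i + \<beta> * V 1 0 i" "\<And>i. w' i = \<alpha>' * V 0 0 i + \<beta>' * V 1 0 i"
    using assms(2,4) unfolding span2_def by blast
  have \<alpha>: "\<alpha> \<noteq> 0"
  proof
    assume \<alpha>: "\<alpha> = 0"
    then have "w = (\<lambda>i. \<beta> * V 1 0 i)" using w by auto
    then have "\<beta> = 0" using not_in_line[of 0 1 1 1 \<beta> 1 0] assms(3) by simp
    then show False using w(1) \<alpha> assms(1) by simp
  qed
  have "(\<lambda>i. \<alpha>' * w i + (- \<alpha>) * w' i) = (\<lambda>i. (\<alpha>' * \<beta> - \<alpha> * \<beta>') * V 1 0 i)"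
    unfolding w by (simp add: algebra_simps)
  moreover have "row 1 (\<lambda>i. \<alpha>' * w i + (- \<alpha>) * w' i)" by (rule span2_lincomb[OF assms(3,5)])
  ultimately have "row 1 (\<lambda>i. (\<alpha>' * \<beta> - \<alpha> * \<beta>') * V 1 0 i)" by argo
  then have "\<alpha>' * \<beta> - \<alpha> * \<beta>' = 0" by (rule not_in_line) simp
  then have "\<alpha>' * w i + (- \<alpha>) * w' i = 0" for i
    using fun_cong[OF \<open>(\<lambda>i. \<alpha>' * w i + (- \<alpha>) * w' i) = _\<close>, of i] by simp
  then have "w' i = \<alpha>' / \<alpha> * w i" for i using \<alpha> by (simp add: field_simps)
  then show ?thesis by blast
qed

lemma rows_concurrent:
  fixes r s :: 'k
  assumes rs: "r \<noteq> 0" "r \<noteq> 1" "s \<noteq> 0" "s \<noteq> 1" "r \<noteq> s"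
  shows "\<exists>w. (\<exists>i. w i \<noteq> 0) \<and> (\<forall>t. row t w)"
proof -
  obtain w where w: "\<exists>i. w i \<noteq> 0" "row 0 w" "row 1 w"
    using three_rows_concurrent[OF rs rs(1,2)] by blast
  have "row t w" for t
  proof (cases "t = 0 \<or> t = 1")
    case False
    then obtain w' where w': "\<exists>i. w' i \<noteq> 0" "row 0 w'" "row 1 w'" "row t w'"
      using three_rows_concurrent[OF rs] by blast
    obtain c where "\<And>i. w i = c * w' i" using rows_0_1_meet[OF w'(1,2,3) w(2,3)] by blast
    then have "w = (\<lambda>i. c * w' i)" by blast
    then show ?thesis using span2_scale[OF w'(4)] by simp
  qed (use w in auto)
  then show ?thesis using w(1) by blast
qed

text \<open>\<open>w\<close> is the vanishing point of the rows. It lies on row 1 and therefore is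
  not proportional to a point of row 0. So \<open>V 0 0\<close> and \<open>w\<close> form a basis of
  row 0 in which each point has a nonzero first coefficient; \<open>f\<close> is the quotient of the
  second coefficient by the first.\<close>

lemma row_coordinate:
  assumes w: "\<exists>i. w i \<noteq> 0" "\<And>t. row t w"
  shows "\<exists>f. f 0 = 0 \<and> (\<forall>x. \<exists>a. a \<noteq> 0 \<and> (\<forall>i. V x 0 i = a * (V 0 0 i + f x * w i)))"
    and "\<exists>a b. b \<noteq> 0 \<and> (\<forall>i. w i = a * V 0 0 i + b * V 1 0 i)"
proof -
  obtain \<alpha> \<beta> where wd: "\<And>i. w i = \<alpha> * V 0 0 i + \<beta> * V 1 0 i"
    using w(2)[of 0] unfolding span2_def by blast
  have \<beta>: "\<beta> \<noteq> 0"
  proof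
    assume \<beta>: "\<beta> = 0"
    then have "w = (\<lambda>i. \<alpha> * V 0 0 i)" using wd by auto
    then have "row 1 (\<lambda>i. \<alpha> * V 0 0 i)" using w(2)[of 1] by simp
    then have "\<alpha> = 0" by (rule not_in_line) simp
    then show False using wd \<beta> w(1) by simp
  qed
  have "\<exists>c. \<exists>a. a \<noteq> 0 \<and> (\<forall>i. V x 0 i = a * (V 0 0 i + c * w i))" for x
  proof -
    obtain p q where "\<And>i. V x 0 i = p * V 0 0 i + q * V 1 0 i"
      using row_point[of 0 x] unfolding span2_def by blast
    moreover have "V 1 0 i = (w i - \<alpha> * V 0 0 i) / \<beta>" for i using wd[of i] \<beta> by simp
    ultimately have e: "V x 0 i = (p - q * \<alpha> / \<beta>) * V 0 0 i + (q / \<beta>) * w i" for i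
      using \<beta> by (simp add: field_simps)
    let ?a = "p - q * \<alpha> / \<beta>"
    have "?a \<noteq> 0"
    proof
      assume "?a = 0"
      then have "(\<lambda>i. 1 * V x 0 i) = (\<lambda>i. (q / \<beta>) * w i)" using e by simp
      moreover have "row 1 (\<lambda>i. (q / \<beta>) * w i)" by (rule span2_scale[OF w(2)])
      ultimately have "row 1 (\<lambda>i. 1 * V x 0 i)" by argo
      then have "(1 :: 'c) = 0" by (rule not_in_line) simp
      then show False by simp
    qed
    then have "V x 0 i = ?a * (V 0 0 i + ((q / \<beta>) / ?a) * w i)" for i using e[of i] by (simp add: distrib_left)
    then show ?thesis using \<open>?a \<noteq> 0\<close> by blast
  qed
  then obtain g where g: "\<And>x. \<exists>a. a \<noteq> 0 \<and> (\<forall>i. V x 0 i = a * (V 0 0 i + g x * w i))" by metis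
  let ?f = "\<lambda>x. if x = 0 then 0 else g x"
  have "\<exists>a. a \<noteq> 0 \<and> (\<forall>i. V x 0 i = a * (V 0 0 i + ?f x * w i))" for x
    using g[of x] by (cases "x = 0") (auto intro: exI[of _ 1])
  then show "\<exists>f. f 0 = 0 \<and> (\<forall>x. \<exists>a. a \<noteq> 0 \<and> (\<forall>i. V x 0 i = a * (V 0 0 i + f x * w i)))"
    by (intro exI[of _ ?f]) simp
  show "\<exists>a b. b \<noteq> 0 \<and> (\<forall>i. w i = a * V 0 0 i + b * V 1 0 i)" using wd \<beta> by blast
qed

lemma product_coordinates:
  fixes r s :: 'k
  assumes rs: "r \<noteq> 0" "r \<noteq> 1" "s \<noteq> 0" "s \<noteq> 1" "r \<noteq> s"
  shows "\<exists>(f :: 'k \<Rightarrow> 'c) (g :: 'k \<Rightarrow> 'c) p w u. f 0 = 0 \<and> g 0 = 0 \<and> \<not> dep3 p w u \<and>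
    (\<forall>x y. \<exists>h. h \<noteq> 0 \<and> (\<forall>i. V x y i = h * (p i + f x * w i + g y * u i)))"
proof -
  interpret T: affine_plane_rep "\<lambda>x y. V y x" by (rule transpose)
  let ?o = "V 0 0"
  obtain w where w: "\<exists>i. w i \<noteq> 0" "\<And>t. row t w" using rows_concurrent[OF rs] by blast
  obtain u where u: "\<exists>i. u i \<noteq> 0" "\<And>t. T.row t u" using T.rows_concurrent[OF rs] by blast
  obtain f where f: "f 0 = 0" "\<And>x. \<exists>a. a \<noteq> 0 \<and> (\<forall>i. V x 0 i = a * (?o i + f x * w i))"
    using row_coordinate(1)[OF w] by blast
  obtain g where g: "g 0 = 0" "\<And>y. \<exists>a. a \<noteq> 0 \<and> (\<forall>i. V 0 y i = a * (?o i + g y * u i))"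
    using T.row_coordinate(1)[OF u] by blast
  have indep: "\<not> dep3 ?o w u"
  proof
    assume "dep3 ?o w u"
    then obtain \<alpha> \<beta> \<gamma> where nz: "\<alpha> \<noteq> 0 \<or> \<beta> \<noteq> 0 \<or> \<gamma> \<noteq> 0"
      and r: "\<And>i. \<alpha> * ?o i + \<beta> * w i + \<gamma> * u i = 0" unfolding dep3_def by blast
    obtain a b a' b' where wu: "\<And>i. w i = a * ?o i + b * V 1 0 i" "\<And>i. u i = a' * ?o i + b' * V 0 1 i"
      and b: "b \<noteq> 0" "b' \<noteq> 0" using row_coordinate(2)[OF w] T.row_coordinate(2)[OF u] by blast
    have "\<not> dep3 ?o (V 1 0) (V 0 1)" by (simp add: dep)
    moreover have "(\<alpha> + \<beta> * a + \<gamma> * a') * ?o i + (\<beta> * b) * V 1 0 i + (\<gamma> * b') * V 0 1 i = 0" for i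
      using r[of i] unfolding wu by (simp add: algebra_simps)
    ultimately have "\<alpha> + \<beta> * a + \<gamma> * a' = 0" "\<beta> * b = 0" "\<gamma> * b' = 0" using indep3D by metis+
    then show False using nz b by simp
  qed
  have "\<exists>h. h \<noteq> 0 \<and> (\<forall>i. V x y i = h * (?o i + f x * w i + g y * u i))" for x y
  proof -
    obtain a where a: "a \<noteq> 0" "\<And>i. V x 0 i = a * (?o i + f x * w i)" using f(2) by blast
    obtain b where b: "b \<noteq> 0" "\<And>i. V 0 y i = b * (?o i + g y * u i)" using g(2) by blast
    \<comment> \<open>In \<open>X\<close> column \<open>x\<close> becomes row 0, in \<open>Y\<close>
      row \<open>y\<close> does. Thus \<open>V x y\<close> is reached from \<open>V x 0\<close>
      along \<open>u\<close> and from \<open>V 0 y\<close> along \<open>w\<close>; comparing the two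
      expressions gives the product form.\<close>
    interpret X: affine_plane_rep "\<lambda>y' x'. V (x' + x) y'"
      by unfold_locales (simp add: dep, simp only: mult.commute eq_commute)
    interpret Y: affine_plane_rep "\<lambda>x' y'. V x' (y' + y)"
      by unfold_locales (simp add: dep)
    have X: "X.row 0 u" using u(2)[of x] by simp
    have Y: "Y.row 0 w" using w(2)[of y] by simp
    have "X.row t u" for t using u(2)[of "t + x"] by simp
    then obtain f' where "\<exists>c. c \<noteq> 0 \<and> (\<forall>i. V x y i = c * (V x 0 i + f' * u i))"
      using X.row_coordinate(1)[OF u(1)] by (metis add_0)
    then obtain c f' where c: "c \<noteq> 0" "\<And>i. V x y i = c * (V x 0 i + f' * u i)" by blast
    have "Y.row t w" for t using w(2)[of "t + y"] by simp
    then obtain g' where "\<exists>d. d \<noteq> 0 \<and> (\<forall>i. V x y i = d * (V 0 y i + g' * w i))"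
      using Y.row_coordinate(1)[OF w(1)] by (metis add_0)
    then obtain d g' where d: "d \<noteq> 0" "\<And>i. V x y i = d * (V 0 y i + g' * w i)" by blast
    have "(c * a - d * b) * ?o i + (c * a * f x - d * g') * w i + (c * f' - d * b * g y) * u i = 0" for i
    proof -
      have "c * (a * (?o i + f x * w i) + f' * u i) = d * (b * (?o i + g y * u i) + g' * w i)"
        using trans[OF c(2)[of i, symmetric] d(2)[of i]] by (simp only: a(2) b(2))
      then show ?thesis by (simp add: algebra_simps)
    qed
    from indep3D[OF indep this] have e: "c * a = d * b" "c * f' = d * b * g y" by simp_all
    have "V x y i = (c * a) * (?o i + f x * w i) + (c * f') * u i" for i
      unfolding c(2) a(2) by (simp add: algebra_simps)
    then have "V x y i = (c * a) * (?o i + f x * w i + g y * u i)" for i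
      unfolding e by (simp add: algebra_simps)
    then show ?thesis using c(1) a(1) by (metis mult_eq_0_iff)
  qed
  then show ?thesis using f(1) g(1) indep by blast
qed

text \<open>In the basis \<open>p\<close>, \<open>w\<close>, \<open>u\<close> the point (x, y) has
  coordinates proportional to (1, f x, g y), so collinear points have collinear images (f x, g y).
  Equal values of \<open>f\<close> or \<open>g\<close> at different arguments would make two
  different points proportional.\<close>

lemma coordinate_functions:
  fixes r s :: 'k
  assumes rs: "r \<noteq> 0" "r \<noteq> 1" "s \<noteq> 0" "s \<noteq> 1" "r \<noteq> s"
  shows "\<exists>(f :: 'k \<Rightarrow> 'c) (g :: 'k \<Rightarrow> 'c). f 0 = 0 \<and> g 0 = 0 \<and> inj f \<and> inj g \<and>
    (\<forall>x1 y1 x2 y2 x3 y3. (x2 - x1) * (y3 - y1) = (x3 - x1) * (y2 - y1) \<longrightarrow>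
      (f x2 - f x1) * (g y3 - g y1) = (f x3 - f x1) * (g y2 - g y1))"
proof -
  obtain f g :: "'k \<Rightarrow> 'c" and p w u where fg: "f 0 = 0" "g 0 = 0" and indep: "\<not> dep3 p w u"
    and "\<And>x y. \<exists>h. h \<noteq> 0 \<and> (\<forall>i. V x y i = h * (p i + f x * w i + g y * u i))"
    using product_coordinates[OF rs] by blast
  then obtain h where h: "\<And>x y. h x y \<noteq> 0" "\<And>x y i. V x y i = h x y * (p i + f x * w i + g y * u i)" by metis
  have "x = y" if "f x = f y" for x y
  proof (rule ccontr)
    assume "x \<noteq> y"
    have "h y 0 * V x 0 i + (- h x 0) * V y 0 i = 0" for i unfolding h(2) that by (simp add: algebra_simps)
    then show False using indep2D(1)[of x 0 y 0 "h y 0"] h(1) \<open>x \<noteq> y\<close> by blast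
  qed
  then have "inj f" by (rule injI)
  have "x = y" if "g x = g y" for x y
  proof (rule ccontr)
    assume "x \<noteq> y"
    have "h 0 y * V 0 x i + (- h 0 x) * V 0 y i = 0" for i unfolding h(2) that by (simp add: algebra_simps)
    then show False using indep2D(1)[of 0 x 0 y "h 0 y"] h(1) \<open>x \<noteq> y\<close> by blast
  qed
  then have "inj g" by (rule injI)
  have "(f x2 - f x1) * (g y3 - g y1) = (f x3 - f x1) * (g y2 - g y1)"
    if "(x2 - x1) * (y3 - y1) = (x3 - x1) * (y2 - y1)" for x1 y1 x2 y2 x3 y3
  proof -
    have V: "V x y = (\<lambda>i. h x y * p i + (h x y * f x) * w i + (h x y * g y) * u i)" for x y
      unfolding fun_eq_iff h(2) by (simp add: algebra_simps)
    have "dep3 (V x1 y1) (V x2 y2) (V x3 y3)" using that dep by blast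
    from det3_coordinates[OF indep this[unfolded V]]
    have "(h x1 y1 * h x2 y2 * h x3 y3) * ((f x2 - f x1) * (g y3 - g y1) - (f x3 - f x1) * (g y2 - g y1)) = 0"
      by (simp only: algebra_simps)
    then show ?thesis using h(1) by simp
  qed
  then show ?thesis using fg \<open>inj f\<close> \<open>inj g\<close> by blast
qed

end

section \<open>From collinearity to an injective ring homomorphism\<close>

lemma no_complex_plane_rep:
  fixes V :: "'k::{field,finite} \<Rightarrow> 'k \<Rightarrow> 'i \<Rightarrow> 'c::field_char_0"
  assumes "affine_plane_rep V" "CARD('k) \<ge> 4"
  shows False
proof -
  interpret affine_plane_rep V by (rule assms(1))
  have ex: "\<exists>x. x \<notin> A" if "card A < 4" for A :: "'k set"
  proof (rule ccontr)
    assume "\<not> ?thesis"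
    then have "A = UNIV" by blast
    then show False using that assms(2) by simp
  qed
  obtain r :: 'k where r: "r \<noteq> 0" "r \<noteq> 1" using ex[of "{0, 1}"] by auto
  obtain s where s: "s \<noteq> 0" "s \<noteq> 1" "r \<noteq> s" using ex[of "{0, 1, r}"] r by auto
  obtain f g :: "'k \<Rightarrow> 'c" where fg: "f 0 = 0" "g 0 = 0" "inj f" "inj g"
    and coll: "\<And>x1 y1 x2 y2 x3 y3. (x2 - x1) * (y3 - y1) = (x3 - x1) * (y2 - y1) \<Longrightarrow>
      (f x2 - f x1) * (g y3 - g y1) = (f x3 - f x1) * (g y2 - g y1)"
    using coordinate_functions[OF r s] by blast
  have nz: "f x \<noteq> 0" "g x \<noteq> 0" if "x \<noteq> 0" for x using fg that by (metis injD)+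
  define F where "F x = f x / f 1" for x
  have nz1: "f 1 \<noteq> 0" "g 1 \<noteq> 0" using nz by simp_all
  have f: "f x = f 1 * F x" for x using nz1 by (simp add: F_def)
  \<comment> \<open>The diagonal through (0, 0), (1, 1), (x, x) ties \<open>g\<close> to
    \<open>f\<close>.\<close>
  have g: "g x = g 1 * F x" for x using coll[of 1 0 x 0 x 1] fg nz1 by (simp add: F_def field_simps)
  have F0: "F 0 = 0" "F 1 = 1" using fg nz1 by (simp_all add: F_def)
  have F: "(F x2 - F x1) * (F y3 - F y1) = (F x3 - F x1) * (F y2 - F y1)"
    if "(x2 - x1) * (y3 - y1) = (x3 - x1) * (y2 - y1)" for x1 y1 x2 y2 x3 y3
  proof -
    have df: "f x - f y = f 1 * (F x - F y)" for x y
      unfolding right_diff_distrib f[of x, symmetric] f[of y, symmetric] ..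
    have dg: "g x - g y = g 1 * (F x - F y)" for x y
      unfolding right_diff_distrib g[of x, symmetric] g[of y, symmetric] ..
    have "(f 1 * (F x2 - F x1)) * (g 1 * (F y3 - F y1)) = (f 1 * (F x3 - F x1)) * (g 1 * (F y2 - F y1))"
      using coll[OF that] by (simp only: df dg)
    then have "(f 1 * g 1) * ((F x2 - F x1) * (F y3 - F y1)) = (f 1 * g 1) * ((F x3 - F x1) * (F y2 - F y1))"
      by (simp only: ac_simps)
    then show ?thesis using nz1 by simp
  qed
  have inj: "inj F" using fg(3) nz1 unfolding F_def inj_def by simp
  \<comment> \<open>Products come from the line through (0, 0), (1, t), (a, t a), sums from the line
    through (0, c), (1, 1 + c), (a, a + c).\<close>
  have mult: "F (t * a) = F t * F a" for t a
    using F[of 1 0 "t * a" 0 a t] F0 by (simp add: mult.commute)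
  have add': "F (a + c) = F c + F a * (F (1 + c) - F c)" for a c
    using F[of 1 0 "a + c" c a "1 + c"] F0 by (simp add: algebra_simps)
  \<comment> \<open>The defect of additivity at 1 + 1 governs all sums:
    \<open>F (a + c) = F a + F c + l * F a * F c\<close>. Since \<open>F (r + r)\<close> is also
    \<open>F r * F (1 + 1)\<close>, it follows that \<open>l * F r * (F r - 1) = 0\<close>, and
    \<open>r\<close> differs from 0 and 1.\<close>
  define l where "l = F (1 + 1) - 2"
  have F1: "F (1 + c) = F c + 1 + l * F c" for c
    using add'[of c 1] F0 by (simp add: l_def algebra_simps)
  have add: "F (a + c) = F a + F c + l * F a * F c" for a c
    unfolding add'[of a c] F1 by (simp add: algebra_simps)
  have "F r * F (1 + 1) = F r * (2 + l)" by (simp add: l_def)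
  moreover have "F r * F (1 + 1) = F (r + r)"
    unfolding mult[symmetric] by (simp only: distrib_left mult_1_right)
  ultimately have "l * F r * (F r - 1) = 0" using add[of r r] by (simp add: algebra_simps)
  moreover have "F r \<noteq> 0" "F r \<noteq> 1" using r inj F0 by (metis injD)+
  ultimately have "l = 0" by simp
  \<comment> \<open>Characteristic 0 of the target enters here: the naturals would embed into the
    finite field.\<close>
  then have "F (of_nat n) = of_nat n" for n by (induction n) (simp_all add: F0 add)
  then have "inj (of_nat :: nat \<Rightarrow> 'k)" by (metis injI of_nat_eq_iff)
  then show False using infinite_UNIV_nat finite_imageD[of "of_nat :: nat \<Rightarrow> 'k" UNIV] by simp
qed

section \<open>Affine three-space over the field with three elements\<close>

definition proportional :: "('i \<Rightarrow> 'c::field) \<Rightarrow> ('i \<Rightarrow> 'c) \<Rightarrow> bool" where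
  "proportional u v \<longleftrightarrow> (\<exists>c. c \<noteq> 0 \<and> u = (\<lambda>i. c * v i))"

lemma proportional_refl: "proportional u u"
  unfolding proportional_def by (intro exI[of _ 1]) simp

lemma proportional_sym: "proportional v u" if "proportional u v"
proof -
  obtain c where "c \<noteq> 0" "u = (\<lambda>i. c * v i)" using \<open>proportional u v\<close> unfolding proportional_def by blast
  then have "inverse c \<noteq> 0" "v = (\<lambda>i. inverse c * u i)" by (simp_all add: mult.assoc[symmetric])
  then show ?thesis unfolding proportional_def by blast
qed

lemma proportional_trans:
  assumes "proportional u v" "proportional v w"
  shows "proportional u w"
proof -
  obtain c d where "c \<noteq> 0" "d \<noteq> 0" "u = (\<lambda>i. c * v i)" "v = (\<lambda>i. d * w i)"
    using assms unfolding proportional_def by blast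
  then have "c * d \<noteq> 0" "u = (\<lambda>i. (c * d) * w i)" by (simp_all add: mult.assoc)
  then show ?thesis unfolding proportional_def by blast
qed

lemma dep3_proportionalD:
  assumes "dep3 u v w" "proportional u u'" "proportional v v'" "proportional w w'"
  shows "dep3 u' v' w'"
proof -
  obtain c d e where n: "c \<noteq> 0" "d \<noteq> 0" "e \<noteq> 0" "u = (\<lambda>i. c * u' i)" "v = (\<lambda>i. d * v' i)" "w = (\<lambda>i. e * w' i)"
    using assms(2-4) unfolding proportional_def by blast
  obtain \<alpha> \<beta> \<gamma> where "\<alpha> \<noteq> 0 \<or> \<beta> \<noteq> 0 \<or> \<gamma> \<noteq> 0" "\<And>i. \<alpha> * u i + \<beta> * v i + \<gamma> * w i = 0"
    using assms(1) unfolding dep3_def by blast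
  then have "\<alpha> * c \<noteq> 0 \<or> \<beta> * d \<noteq> 0 \<or> \<gamma> * e \<noteq> 0" "\<And>i. (\<alpha> * c) * u' i + (\<beta> * d) * v' i + (\<gamma> * e) * w' i = 0"
    using n by (simp_all add: mult.assoc)
  then show ?thesis unfolding dep3_def by blast
qed

lemma dep3_proportional:
  assumes "proportional u u'" "proportional v v'" "proportional w w'"
  shows "dep3 u v w \<longleftrightarrow> dep3 u' v' w'"
  using assms dep3_proportionalD proportional_sym by blast

lemma cube_root_cases:
  fixes s t :: "'c::field"
  assumes "t\<^sup>2 + t + 1 = 0" "s\<^sup>2 + s + 1 = 0"
  shows "s = t \<or> s = t\<^sup>2"
proof -
  have "(s - t) * (s + t + 1) = (s\<^sup>2 + s + 1) - (t\<^sup>2 + t + 1)" by (simp add: algebra_simps power2_eq_square)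
  then have "s = t \<or> s + t + 1 = 0" using assms by simp
  moreover have "s = t\<^sup>2" if "s + t + 1 = 0"
  proof -
    have "s - t\<^sup>2 = (s + t + 1) - (t\<^sup>2 + t + 1)" by simp
    then show ?thesis using that assms(1) by simp
  qed
  ultimately show ?thesis by blast
qed

text \<open>Affine space over three elements enters only as an abelian group with 3x = 0, where
  three different points are collinear exactly if their sum is 0. \<open>fourth\<close> supplies a
  point off the line through two given points, so different points have non-proportional
  vectors.\<close>

locale elementary_3_rep =
  fixes V :: "'v::ab_group_add \<Rightarrow> 'i \<Rightarrow> 'c::field_char_0"
  assumes three: "x + x + x = (0 :: 'v)"
    and dep: "dep3 (V p) (V q) (V r) \<longleftrightarrow> p = q \<or> q = r \<or> p = r \<or> p + q + r = 0"
    and fourth: "\<exists>x. x \<noteq> p \<and> x \<noteq> q \<and> x \<noteq> r"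
begin

definition ind :: "'v \<Rightarrow> 'v \<Rightarrow> bool" where
  "ind a b \<longleftrightarrow> a \<noteq> 0 \<and> b \<noteq> 0 \<and> a \<noteq> b \<and> a \<noteq> - b"

lemma double: "x + x = - (x :: 'v)"
  using three[of x] by (simp add: eq_neg_iff_add_eq_0)

lemma neq_uminus: "x \<noteq> 0 \<Longrightarrow> x \<noteq> - (x :: 'v)"
  using three[of x] double[of x] by (metis add_0 add.right_inverse)

lemma indep_0: "ind a b \<Longrightarrow> \<not> dep3 (V 0) (V a) (V b)"
  unfolding dep ind_def by (auto simp: eq_neg_iff_add_eq_0)

lemma indep_pairD:
  assumes "p \<noteq> q" "\<And>i. \<alpha> * V p i + \<beta> * V q i = 0"
  shows "\<alpha> = 0" "\<beta> = 0"
proof -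
  obtain r where "r \<noteq> p" "r \<noteq> q" "r \<noteq> - (p + q)" using fourth by blast
  moreover have "p + q + r \<noteq> 0" using \<open>r \<noteq> - (p + q)\<close> by (metis add.commute eq_neg_iff_add_eq_0)
  ultimately have n: "\<not> dep3 (V p) (V q) (V r)" using assms(1) unfolding dep by blast
  have "\<alpha> * V p i + \<beta> * V q i + 0 * V r i = 0" for i using assms(2) by simp
  from indep3D[OF n this] show "\<alpha> = 0" "\<beta> = 0" by blast+
qed

lemma third_distinct:
  assumes "p \<noteq> q" "p + q + r = (0 :: 'v)"
  shows "p \<noteq> r" "q \<noteq> r"
  using assms three[of p] three[of q] by (metis add.commute add_left_cancel)+

lemma line_combination:
  assumes "p \<noteq> q" "p + q + r = 0" "proportional P (V p)" "proportional Q (V q)"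
  obtains x y where "x \<noteq> 0" "y \<noteq> 0" "V r = (\<lambda>i. x * P i + y * Q i)"
proof -
  obtain c d where cd: "c \<noteq> 0" "d \<noteq> 0" "P = (\<lambda>i. c * V p i)" "Q = (\<lambda>i. d * V q i)"
    using assms(3,4) unfolding proportional_def by blast
  have "dep3 (V p) (V q) (V r)" using assms(2) by (simp add: dep)
  then obtain \<alpha> \<beta> \<gamma> where nz: "\<alpha> \<noteq> 0 \<or> \<beta> \<noteq> 0 \<or> \<gamma> \<noteq> 0" and e: "\<And>i. \<alpha> * V p i + \<beta> * V q i + \<gamma> * V r i = 0"
    unfolding dep3_def by blast
  have "\<gamma> \<noteq> 0" using indep_pairD[OF assms(1), of \<alpha> \<beta>] e nz by force
  moreover have "\<beta> \<noteq> 0" using indep_pairD[OF third_distinct(1)[OF assms(1,2)], of \<alpha> \<gamma>] e nz by force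
  moreover have "\<alpha> \<noteq> 0" using indep_pairD[OF third_distinct(2)[OF assms(1,2)], of \<beta> \<gamma>] e nz by force
  moreover have "V r i = (- \<alpha> / (\<gamma> * c)) * P i + (- \<beta> / (\<gamma> * d)) * Q i" for i
  proof -
    have "\<gamma> * V r i = - \<alpha> * V p i - \<beta> * V q i" using e[of i] by (simp add: algebra_simps eq_neg_iff_add_eq_0)
    then have "V r i = (- \<alpha> * V p i - \<beta> * V q i) / \<gamma>" using \<open>\<gamma> \<noteq> 0\<close> by (simp add: eq_divide_eq mult.commute)
    then show ?thesis using cd \<open>\<gamma> \<noteq> 0\<close> by (simp add: field_simps)
  qed
  ultimately show thesis using that[of "- \<alpha> / (\<gamma> * c)" "- \<beta> / (\<gamma> * d)"] cd by fastforce
qed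

lemma line_point:
  assumes "p \<noteq> q" "p + q + r = 0" "proportional P (V p)" "proportional Q (V q)"
  obtains t where "t \<noteq> 0" "proportional (\<lambda>i. P i + t * Q i) (V r)"
proof -
  obtain x y where xy: "x \<noteq> 0" "y \<noteq> 0" "V r = (\<lambda>i. x * P i + y * Q i)" using line_combination[OF assms] .
  then have "(\<lambda>i. P i + (y / x) * Q i) = (\<lambda>i. inverse x * V r i)" by (auto simp: field_simps)
  moreover have "inverse x \<noteq> 0" "y / x \<noteq> 0" using xy by simp_all
  ultimately show thesis using that unfolding proportional_def by blast
qed

definition normalized :: "'v \<Rightarrow> ('i \<Rightarrow> 'c) \<Rightarrow> bool" where
  "normalized a H \<longleftrightarrow> proportional H (V a) \<and> proportional (\<lambda>i. V 0 i + H i) (V (- a))"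

lemma normalized_exists:
  assumes "a \<noteq> 0"
  shows "\<exists>H. normalized a H"
proof -
  obtain t where t: "t \<noteq> 0" "proportional (\<lambda>i. V 0 i + t * V a i) (V (- a))"
    using line_point[of 0 a "- a" "V 0" "V a"] assms neq_uminus[OF assms] proportional_refl by auto
  then show ?thesis
    unfolding normalized_def by (intro exI[of _ "\<lambda>i. t * V a i"]) (auto simp: proportional_def)
qed

lemma normalized_unique:
  assumes "a \<noteq> 0" "normalized a H" "normalized a H'"
  shows "H = H'"
proof -
  obtain c d c' d' where e: "H = (\<lambda>i. c * V a i)" "H' = (\<lambda>i. c' * V a i)"
    and f: "(\<lambda>i. V 0 i + H i) = (\<lambda>i. d * V (- a) i)" "(\<lambda>i. V 0 i + H' i) = (\<lambda>i. d' * V (- a) i)"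
    using assms(2,3) unfolding normalized_def proportional_def by blast
  have "(c - c') * V a i + (d' - d) * V (- a) i = 0" for i
  proof -
    have "c * V a i = d * V (- a) i - V 0 i" "c' * V a i = d' * V (- a) i - V 0 i"
      using fun_cong[OF f(1), of i] fun_cong[OF f(2), of i] unfolding e by (simp_all add: eq_diff_eq add.commute)
    then show ?thesis by (simp add: left_diff_distrib)
  qed
  then have "c - c' = 0" by (rule indep_pairD(1)[OF neq_uminus[OF assms(1)]])
  then show ?thesis using e by simp
qed

definition N :: "'v \<Rightarrow> 'i \<Rightarrow> 'c" where
  "N a = (SOME H. normalized a H)"

lemma normalized_N: "a \<noteq> 0 \<Longrightarrow> normalized a (N a)"
  unfolding N_def using someI_ex[OF normalized_exists] .

lemma N_uminus:
  assumes "a \<noteq> 0"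
  shows "N (- a) = (\<lambda>i. - V 0 i - N a i)"
proof (rule normalized_unique)
  have n: "proportional (N a) (V a)" "proportional (\<lambda>i. V 0 i + N a i) (V (- a))"
    using normalized_N[OF assms] unfolding normalized_def by blast+
  have neg: "proportional (\<lambda>i. - u i) v" if "proportional u v" for u v :: "'i \<Rightarrow> 'c"
  proof -
    obtain c where "c \<noteq> 0" "u = (\<lambda>i. c * v i)" using \<open>proportional u v\<close> unfolding proportional_def by blast
    then have "- c \<noteq> 0" "(\<lambda>i. - u i) = (\<lambda>i. (- c) * v i)" by simp_all
    then show ?thesis unfolding proportional_def by blast
  qed
  show "normalized (- a) (\<lambda>i. - V 0 i - N a i)"
    unfolding normalized_def using neg[OF n(1)] neg[OF n(2)] by (simp add: algebra_simps)
  show "normalized (- a) (N (- a))" using normalized_N assms by simp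
qed (use assms in simp)

lemma indep_N:
  assumes "ind a b"
  shows "\<not> dep3 (V 0) (N a) (N b)"
proof -
  have "proportional (N a) (V a)" "proportional (N b) (V b)"
    using normalized_N assms unfolding ind_def normalized_def by blast+
  then show ?thesis using dep3_proportional[OF proportional_refl] indep_0[OF assms] by blast
qed

lemma indep_ND:
  assumes "ind a b" "\<And>i. x * V 0 i + y * N a i + z * N b i = 0"
  shows "y = 0" "z = 0"
  using indep3D[OF indep_N[OF assms(1)] assms(2)] by simp_all

text \<open>The coefficients of the nine points of a plane relative to the origin and two normalized
  points depend on a single primitive cube root of unity.\<close>

definition plane_root :: "'v \<Rightarrow> 'v \<Rightarrow> 'c \<Rightarrow> bool" where
  "plane_root a b t \<longleftrightarrow> t\<^sup>2 + t + 1 = 0 \<and> N (a + b) = (\<lambda>i. - V 0 i + t * N a i + t\<^sup>2 * N b i)"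

text \<open>One line each through known points leaves unknown coefficients \<open>t\<close>,
  \<open>u\<close>, \<open>u'\<close> for \<open>- a - b\<close>, \<open>a - b\<close>,
  \<open>b - a\<close>. Three more lines of the plane give \<open>u = 1 + t\<close>,
  \<open>u * u' = 1\<close> and \<open>t * u' = 1 + t\<close>, whence (1 + t)^2 = t.\<close>

lemma plane_root_exists:
  assumes "ind a b"
  shows "\<exists>t. plane_root a b t"
proof -
  define A B where AB: "A = N a" "B = N b"
  let ?O = "V 0"
  have nz: "a \<noteq> 0" "b \<noteq> 0" "a \<noteq> b" "a \<noteq> - b" "b \<noteq> - a" "a + b \<noteq> 0"
    using assms unfolding ind_def by (simp_all add: eq_neg_iff_add_eq_0 add.commute)
  have pts: "proportional A (V a)" "proportional B (V b)"
    "proportional (\<lambda>i. ?O i + A i) (V (- a))" "proportional (\<lambda>i. ?O i + B i) (V (- b))"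
    using normalized_N nz unfolding AB normalized_def by blast+
  have indep: "\<not> dep3 ?O A B" using indep_N[OF assms] AB by simp
  note ne = nz neq_uminus[OF nz(1)] neq_uminus[OF nz(2)]
  have "\<exists>t. t \<noteq> 0 \<and> proportional (\<lambda>i. A i + t * B i) (V (- a - b))"
    by (rule line_point[OF _ _ pts(1,2)]) (use ne in \<open>auto simp: algebra_simps\<close>)
  then obtain t where t: "t \<noteq> 0" "proportional (\<lambda>i. A i + t * B i) (V (- a - b))" by blast
  have "\<exists>u. proportional (\<lambda>i. (?O i + A i) + u * B i) (V (a - b))"
    by (rule line_point[OF _ _ pts(3,2)]) (use ne in \<open>auto simp: algebra_simps\<close>)
  then obtain u where u: "proportional (\<lambda>i. (?O i + A i) + u * B i) (V (a - b))" by blast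
  have "\<exists>u'. proportional (\<lambda>i. (?O i + B i) + u' * A i) (V (b - a))"
    by (rule line_point[OF _ _ pts(4,1)]) (use ne in \<open>auto simp: algebra_simps\<close>)
  then obtain u' where u': "proportional (\<lambda>i. (?O i + B i) + u' * A i) (V (b - a))" by blast
  \<comment> \<open>The two digits are the coefficients of \<open>a\<close> and \<open>b\<close>
    modulo 3: \<open>P22\<close> is \<open>- a - b\<close>, \<open>P12\<close> is
    \<open>a - b\<close>.\<close>
  have P22: "proportional (\<lambda>i. 0 * ?O i + 1 * A i + t * B i) (V (- a - b))" using t(2) by simp
  have P12: "proportional (\<lambda>i. 1 * ?O i + 1 * A i + u * B i) (V (a - b))" using u by simp
  have P21: "proportional (\<lambda>i. 1 * ?O i + u' * A i + 1 * B i) (V (b - a))" using u' by (simp add: algebra_simps)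
  have P20: "proportional (\<lambda>i. 1 * ?O i + 1 * A i + 0 * B i) (V (- a))" using pts(3) by simp
  have P02: "proportional (\<lambda>i. 1 * ?O i + 0 * A i + 1 * B i) (V (- b))" using pts(4) by simp
  have P00: "proportional (\<lambda>i. 1 * ?O i + 0 * A i + 0 * B i) (V 0)" using proportional_refl by simp
  have "dep3 (V (- a - b)) (V (- a)) (V (b - a))" using three[of a] by (simp add: dep algebra_simps)
  from det3_coordinates[OF indep this[folded dep3_proportional[OF P22 P20 P21]]]
  have e1: "t * u' = 1 + t" by (simp add: algebra_simps)
  have "dep3 (V 0) (V (a - b)) (V (b - a))" by (simp add: dep)
  from det3_coordinates[OF indep this[folded dep3_proportional[OF P00 P12 P21]]]
  have e2: "u * u' = 1" by simp
  have "- b + (a - b) + (- a - b) = - (b + b + b)" by (simp add: algebra_simps)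
  then have "- b + (a - b) + (- a - b) = 0" by (simp only: three minus_zero)
  then have "dep3 (V (- b)) (V (a - b)) (V (- a - b))" unfolding dep by blast
  from det3_coordinates[OF indep this[folded dep3_proportional[OF P02 P12 P22]]]
  have e3: "u = 1 + t" by (simp add: algebra_simps)
  have "t * ((1 + t) * u') = (1 + t) * (t * u')" by (simp only: ac_simps)
  then have "(1 + t) * (1 + t) = t" using e2 unfolding e3 e1 by simp
  then have root: "t\<^sup>2 + t + 1 = 0" by (simp add: algebra_simps power2_eq_square)
  \<comment> \<open>\<open>a + b\<close> lies on the line of \<open>- a\<close> and
    \<open>- b\<close>, and its normalization makes \<open>V 0 + N (a + b)\<close> proportional to
    the vector of \<open>- a - b\<close>; together these fix all coefficients.\<close>
  have "\<exists>x y. V (a + b) = (\<lambda>i. x * (?O i + A i) + y * (?O i + B i))"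
    by (rule line_combination[OF _ _ pts(3,4)]) (use ne in \<open>auto simp: algebra_simps\<close>)
  moreover have N: "proportional (N (a + b)) (V (a + b))" "proportional (\<lambda>i. ?O i + N (a + b) i) (V (- (a + b)))"
    using normalized_N[OF nz(6)] unfolding normalized_def by blast+
  ultimately obtain x y where xy: "N (a + b) = (\<lambda>i. x * (?O i + A i) + y * (?O i + B i))"
    unfolding proportional_def by (force simp: distrib_left mult.assoc[symmetric])
  have "proportional (\<lambda>i. ?O i + N (a + b) i) (\<lambda>i. A i + t * B i)"
    using proportional_trans[OF N(2)] proportional_sym[OF t(2)] by (simp add: algebra_simps)
  then obtain l where l: "(\<lambda>i. ?O i + N (a + b) i) = (\<lambda>i. l * (A i + t * B i))" unfolding proportional_def by blast
  have "(1 + x + y) * ?O i + (x - l) * A i + (y - l * t) * B i = 0" for i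
    using fun_cong[OF l, of i] unfolding xy by (simp add: algebra_simps)
  from indep3D[OF indep this] have c: "1 + x + y = 0" "x = l" "y = l * t" by simp_all
  have "l * (1 + t) = - 1" using c(1) unfolding c(2,3) by (simp add: algebra_simps eq_neg_iff_add_eq_0)
  moreover have "t * (1 + t) = - 1" using root by (simp add: algebra_simps power2_eq_square eq_neg_iff_add_eq_0)
  ultimately have "l * (1 + t) = t * (1 + t)" "1 + t \<noteq> 0" by auto
  then have "l = t" by simp
  have "N (a + b) i = - ?O i + t * A i + t\<^sup>2 * B i" for i
  proof -
    have "N (a + b) i = (1 + x + y) * ?O i - ?O i + x * A i + y * B i" unfolding xy by (simp add: algebra_simps)
    then show ?thesis unfolding c(1) unfolding c(2,3) \<open>l = t\<close> by (simp add: power2_eq_square)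
  qed
  then show ?thesis unfolding plane_root_def AB using root by blast
qed

section \<open>Dependence of the cube root on the two directions\<close>

lemma ind_uminus: "ind a b \<Longrightarrow> ind a (- b)"
  unfolding ind_def by auto

lemma ind_add_diff:
  assumes "ind a b"
  shows "ind (a + b) (a - b)"
proof -
  have "a \<noteq> - a" "b \<noteq> - b" using assms neq_uminus unfolding ind_def by blast+
  moreover have "a + b \<noteq> a - b" using \<open>b \<noteq> - b\<close> by (metis add_left_cancel diff_conv_add_uminus)
  moreover have "a + b \<noteq> - (a - b)" using \<open>a \<noteq> - a\<close> by (metis add.commute add_left_cancel diff_conv_add_uminus minus_diff_eq)
  ultimately show ?thesis using assms unfolding ind_def by (auto simp: eq_neg_iff_add_eq_0)
qed

lemma root_neq:
  fixes t :: 'c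
  assumes "t\<^sup>2 + t + 1 = 0"
  shows "t \<noteq> 1" "t \<noteq> 0" "t\<^sup>2 \<noteq> t" "t ^ 3 = 1"
proof -
  show "t \<noteq> 1" "t \<noteq> 0" using assms by auto
  then show "t\<^sup>2 \<noteq> t" by (simp add: power2_eq_square)
  have "t ^ 3 - 1 = (t - 1) * (t\<^sup>2 + t + 1)" by (simp add: algebra_simps power2_eq_square power3_eq_cube)
  then show "t ^ 3 = 1" using assms by simp
qed

text \<open>\<open>a + a\<close>, which is \<open>- a\<close>, is also the sum of
  \<open>a + b\<close> and \<open>a - b\<close>. In the two expansions of \<open>N (a + a)\<close>
  the coefficients of \<open>N b\<close> give \<open>u * t\<^sup>2 = u\<^sup>2 * t'\<^sup>2\<close>;
  equal roots would force \<open>u = 1\<close>, so \<open>t'\<close> is the other root.\<close>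

lemma plane_root_uminus:
  assumes "ind a b" "plane_root a b t"
  shows "plane_root a (- b) (t\<^sup>2)"
proof -
  let ?O = "V 0"
  have ab: "a \<noteq> 0" "b \<noteq> 0" using assms(1) unfolding ind_def by simp_all
  obtain t' where t': "plane_root a (- b) t'" using plane_root_exists[OF ind_uminus[OF assms(1)]] by blast
  obtain u where u: "plane_root (a + b) (a - b) u" using plane_root_exists[OF ind_add_diff[OF assms(1)]] by blast
  have r: "t\<^sup>2 + t + 1 = 0" "t'\<^sup>2 + t' + 1 = 0" "u\<^sup>2 + u + 1 = 0"
    using assms(2) t' u unfolding plane_root_def by blast+
  have n1: "N (a + b) i = - ?O i + t * N a i + t\<^sup>2 * N b i" for i
    using assms(2) unfolding plane_root_def by simp
  have n2: "N (a - b) i = - ?O i + t' * N a i + t'\<^sup>2 * (- ?O i - N b i)" for i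
    using t' unfolding plane_root_def N_uminus[OF ab(2)] by simp
  have n3: "N (a + a) i = - ?O i + u * N (a + b) i + u\<^sup>2 * N (a - b) i" for i
    using u unfolding plane_root_def by simp
  have n4: "N (a + a) i = - ?O i - N a i" for i
    unfolding double N_uminus[OF ab(1)] ..
  have "(- u - u\<^sup>2 - u\<^sup>2 * t'\<^sup>2) * ?O i + (u * t + u\<^sup>2 * t' + 1) * N a i + (u * t\<^sup>2 - u\<^sup>2 * t'\<^sup>2) * N b i = 0" for i
    using trans[OF n4[of i, symmetric] n3[of i]] unfolding n1 n2 by (simp add: algebra_simps)
  from indep_ND(2)[OF assms(1) this] have "u * t\<^sup>2 = u\<^sup>2 * t'\<^sup>2" by simp
  then have "t' \<noteq> t" using root_neq[OF r(1)] root_neq[OF r(3)] by auto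
  then have "t' = t\<^sup>2" using cube_root_cases[OF r(1,2)] by blast
  then show ?thesis using t' by simp
qed

text \<open>In the picture of an alternating form, \<open>b - c\<close> would be orthogonal to
  \<open>a\<close>. Since \<open>b - c\<close> equals \<open>(a + b) - (a + c)\<close>, the vector
  \<open>N (b - c)\<close> has two expansions, and their difference is a relation between
  \<open>V 0\<close>, \<open>N a\<close>, \<open>N b\<close>, \<open>N c\<close>. These four may be
  dependent, but for every choice of the remaining roots \<open>s\<close> and \<open>w\<close> the
  relation shrinks to three independent vectors with a nonzero coefficient.\<close>

lemma no_common_root:
  assumes ab: "ind a b" and ac: "ind a c" and bc: "ind b c" and "ind c (a + b)" "ind b (a + c)" "c \<noteq> a - b"
    and t: "plane_root a b t" "plane_root a c t"
  shows False
proof -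
  let ?O = "V 0"
  have nz: "b \<noteq> 0" "c \<noteq> 0" "a + b \<noteq> 0" "a + c \<noteq> 0" using assms unfolding ind_def by auto
  have "a + b \<noteq> - (- (a + c))" using bc unfolding ind_def by simp
  moreover have "a + b \<noteq> - (a + c)"
  proof
    assume "a + b = - (a + c)"
    then have "c = - (a + a) - b" by (simp add: algebra_simps eq_neg_iff_add_eq_0)
    then show False using assms(6) by (simp add: double)
  qed
  ultimately have "ind (a + b) (- (a + c))" using nz unfolding ind_def by auto
  then obtain w where w: "plane_root (a + b) (- (a + c)) w" using plane_root_exists by blast
  obtain s where s: "plane_root b c s" using plane_root_exists[OF bc] by blast
  have s': "plane_root b (- c) (s\<^sup>2)" by (rule plane_root_uminus[OF bc s])
  have r: "t\<^sup>2 + t + 1 = 0" "s\<^sup>2 + s + 1 = 0" "w\<^sup>2 + w + 1 = 0"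
    using t s w unfolding plane_root_def by blast+
  have n1: "N (a + b) i = - ?O i + t * N a i + t\<^sup>2 * N b i" for i
    using t(1) unfolding plane_root_def by simp
  have n2: "N (a + c) i = - ?O i + t * N a i + t\<^sup>2 * N c i" for i
    using t(2) unfolding plane_root_def by simp
  have "(s\<^sup>2)\<^sup>2 = s" using root_neq(4)[OF r(2)] by (simp add: power2_eq_square power3_eq_cube mult.assoc)
  then have n3: "N (b - c) i = - ?O i + s\<^sup>2 * N b i + s * (- ?O i - N c i)" for i
    using s' unfolding plane_root_def N_uminus[OF nz(2)] by simp
  have n4: "N (b - c) i = - ?O i + w * N (a + b) i + w\<^sup>2 * (- ?O i - N (a + c) i)" for i
    using w unfolding plane_root_def N_uminus[OF nz(4)] by simp
  have rel: "\<exists>k. \<forall>i. k * ?O i + (w - w\<^sup>2) * t * N a i + (w * t\<^sup>2 - s\<^sup>2) * N b i + (s - w\<^sup>2 * t\<^sup>2) * N c i = 0"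
  proof (intro exI[of _ "s - w"] allI)
    fix i
    show "(s - w) * ?O i + (w - w\<^sup>2) * t * N a i + (w * t\<^sup>2 - s\<^sup>2) * N b i + (s - w\<^sup>2 * t\<^sup>2) * N c i = 0"
      using trans[OF n3[of i, symmetric] n4[of i]] unfolding n1 n2 by (simp add: algebra_simps)
  qed
  then obtain k where k: "\<And>i. k * ?O i + (w - w\<^sup>2) * t * N a i + (w * t\<^sup>2 - s\<^sup>2) * N b i + (s - w\<^sup>2 * t\<^sup>2) * N c i = 0"
    by blast
  have t3: "t\<^sup>2 * t = 1" "t\<^sup>2 * t\<^sup>2 = t" "t * t\<^sup>2 = 1" "t * t = t\<^sup>2"
    using root_neq(4)[OF r(1)] by (simp_all add: power2_eq_square power3_eq_cube mult.assoc)
  have t4: "(t\<^sup>2)\<^sup>2 = t" using t3(2) by (simp add: power2_eq_square)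
  note tn = root_neq[OF r(1)]
  consider "w = t" "s = t" | "w = t\<^sup>2" "s = t\<^sup>2" | "w = t" "s = t\<^sup>2" | "w = t\<^sup>2" "s = t"
    using cube_root_cases[OF r(1,2)] cube_root_cases[OF r(1,3)] by blast
  then show False
  proof cases
    \<comment> \<open>The coefficient \<open>s - w\<^sup>2 * t\<^sup>2\<close> of \<open>N c\<close>
      is 0 because the cube of \<open>t\<close> is 1; in the second case \<open>N b\<close> drops
      out likewise.\<close>
    case 1
    have "k * ?O i + (t - t\<^sup>2) * t * N a i + (t * t\<^sup>2 - t\<^sup>2) * N b i = 0" for i
      using k[of i] unfolding 1 t3 by simp
    from indep_ND(1)[OF ab this] show False using tn by simp
  next
    case 2
    have "k * ?O i + (t\<^sup>2 - t) * t * N a i + (t\<^sup>2 - t * t\<^sup>2) * N c i = 0" for i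
      using k[of i] unfolding 2 t4 t3 by simp
    from indep_ND(1)[OF ac this] show False using tn by simp
  next
    \<comment> \<open>Up to a multiple of \<open>V 0\<close>, the terms in \<open>N a\<close> and
      \<open>N b\<close> combine to a multiple of \<open>N (a + b)\<close>, which leaves a relation
      in the plane of \<open>c\<close> and \<open>a + b\<close>. In the fourth case
      \<open>N a\<close> and \<open>N c\<close> combine to \<open>N (a + c)\<close>.\<close>
    case 3
    have "t * t\<^sup>2 - (t\<^sup>2)\<^sup>2 = (t - t\<^sup>2) * t\<^sup>2" by (simp add: left_diff_distrib power2_eq_square[of "t\<^sup>2"])
    then have "k * ?O i + (t - t\<^sup>2) * t * N a i + (t - t\<^sup>2) * t\<^sup>2 * N b i + (t\<^sup>2 - t) * N c i = 0" for i
      using k[of i] unfolding 3 t3(2) by simp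
    moreover have "(k + X) * ?O i + Y * N c i + X * (- ?O i + t * N a i + t\<^sup>2 * N b i)
        = k * ?O i + X * t * N a i + X * t\<^sup>2 * N b i + Y * N c i" for X Y i
      by (simp add: algebra_simps)
    ultimately have "(k + (t - t\<^sup>2)) * ?O i + (t\<^sup>2 - t) * N c i + (t - t\<^sup>2) * N (a + b) i = 0" for i
      unfolding n1 by presburger
    from indep_ND(1)[OF assms(4) this] show False using tn by simp
  next
    case 4
    have "t - (t\<^sup>2)\<^sup>2 * t\<^sup>2 = (t\<^sup>2 - t) * t\<^sup>2" "t\<^sup>2 * t\<^sup>2 - t\<^sup>2 = t - t\<^sup>2"
      unfolding left_diff_distrib t4 t3 by (rule refl)+
    then have "k * ?O i + (t\<^sup>2 - t) * t * N a i + (t - t\<^sup>2) * N b i + (t\<^sup>2 - t) * t\<^sup>2 * N c i = 0" for i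
      using k[of i] unfolding 4 t4 by simp
    moreover have "(k + X) * ?O i + Y * N b i + X * (- ?O i + t * N a i + t\<^sup>2 * N c i)
        = k * ?O i + X * t * N a i + Y * N b i + X * t\<^sup>2 * N c i" for X Y i
      by (simp add: algebra_simps)
    ultimately have "(k + (t\<^sup>2 - t)) * ?O i + (t - t\<^sup>2) * N b i + (t\<^sup>2 - t) * N (a + c) i = 0" for i
      unfolding n2 by presburger
    from indep_ND(1)[OF assms(5) this] show False using tn by simp
  qed
qed

text \<open>The nine excluded points form the plane spanned by \<open>a\<close> and
  \<open>b\<close>. Replacing \<open>c\<close> by \<open>- c\<close> squares its root with
  \<open>a\<close>, so the roots of \<open>a, b\<close> and of \<open>a, c\<close> may be assumed
  equal.\<close>

theorem no_three_independent:
  assumes ab: "ind a b" and c: "c \<notin> {0, a, - a, b, - b, a + b, - (a + b), a - b, b - a}"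
  shows False
proof -
  have indep: "ind a d" "ind b d" "ind d (a + b)" "ind b (a + d)" "d \<noteq> a - b"
    if d: "d \<notin> {0, a, - a, b, - b, a + b, - (a + b), a - b, b - a}" for d
  proof -
    have ne: "d \<noteq> 0" "d \<noteq> a" "d \<noteq> - a" "d \<noteq> b" "d \<noteq> - b" "d \<noteq> a + b" "d \<noteq> - (a + b)" "d \<noteq> a - b" "d \<noteq> b - a"
      using d by blast+
    have nab: "a \<noteq> 0" "b \<noteq> 0" "a + b \<noteq> 0" using ab unfolding ind_def by (auto simp: eq_neg_iff_add_eq_0)
    have ne': "a \<noteq> - d" "b \<noteq> - d" using ne by auto
    show "ind a d" "ind b d" "ind d (a + b)" using ne ne' nab unfolding ind_def by auto
    have "a + d \<noteq> 0" "b \<noteq> a + d" using ne ne' by (auto simp: eq_neg_iff_add_eq_0)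
    moreover have "b \<noteq> - (a + d)"
    proof
      assume "b = - (a + d)"
      then have "d = - (a + b)" by (simp add: algebra_simps)
      then show False using ne by simp
    qed
    ultimately show "ind b (a + d)" using nab unfolding ind_def by auto
    show "d \<noteq> a - b" by (rule ne)
  qed
  have c': "- c \<notin> {0, a, - a, b, - b, a + b, - (a + b), a - b, b - a}"
    using c by (auto simp: minus_equation_iff[of c] algebra_simps)
  obtain t where t: "plane_root a b t" using plane_root_exists[OF ab] by blast
  obtain s where s: "plane_root a c s" using plane_root_exists[OF indep(1)[OF c]] by blast
  have "t\<^sup>2 + t + 1 = 0" "s\<^sup>2 + s + 1 = 0" using t s unfolding plane_root_def by blast+
  then consider "s = t" | "t = s\<^sup>2" using cube_root_cases by blast
  then show False
  proof cases
    case 1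
    then show False using no_common_root[OF ab indep[OF c] t] s by blast
  next
    case 2
    then show False
      using no_common_root[OF ab indep[OF c'] t] plane_root_uminus[OF indep(1)[OF c] s] by blast
  qed
qed

end

section \<open>Affine dependence of three points\<close>

lemma affinely_dependent_triple:
  fixes p q r :: "'k::field ^ 'm::finite"
  assumes "p \<noteq> q" "p \<noteq> r" "q \<noteq> r"
  shows "affinely_dependent {p, q, r} \<longleftrightarrow>
    (\<exists>a b c. (a \<noteq> 0 \<or> b \<noteq> 0 \<or> c \<noteq> 0) \<and> a + b + c = 0 \<and> (\<forall>n. a * vec_nth p n + b * vec_nth q n + c * vec_nth r n = 0))"
    (is "_ \<longleftrightarrow> ?R")
proof
  assume "affinely_dependent {p, q, r}"
  then obtain T u where T: "finite T" "T \<subseteq> {p, q, r}" "(\<Sum>v\<in>T. u v) = 0" "\<exists>v\<in>T. u v \<noteq> 0" "(\<Sum>v\<in>T. u v *s v) = 0"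
    unfolding affinely_dependent_def by blast
  define w where "w v = (if v \<in> T then u v else 0)" for v
  have "(\<Sum>v\<in>{p, q, r}. w v) = (\<Sum>v\<in>T. u v)"
    by (rule sum.mono_neutral_cong_right) (use T in \<open>auto simp: w_def\<close>)
  then have 1: "w p + w q + w r = 0" using assms T(3) by (simp add: add.assoc)
  have "(\<Sum>v\<in>{p, q, r}. w v *s v) = (\<Sum>v\<in>T. u v *s v)"
    by (rule sum.mono_neutral_cong_right) (use T in \<open>auto simp: w_def\<close>)
  then have 2: "w p *s p + w q *s q + w r *s r = 0" using assms T(5) by (simp add: add.assoc)
  have "w p * vec_nth p n + w q * vec_nth q n + w r * vec_nth r n = 0" for n
    using arg_cong[OF 2, of "\<lambda>v. vec_nth v n"] by simp
  moreover have "w p \<noteq> 0 \<or> w q \<noteq> 0 \<or> w r \<noteq> 0" using T(2,4) unfolding w_def by auto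
  ultimately show ?R using 1 by blast
next
  assume ?R
  then obtain a b c where nz: "a \<noteq> 0 \<or> b \<noteq> 0 \<or> c \<noteq> 0" and s: "a + b + c = 0"
    and l: "\<And>n. a * vec_nth p n + b * vec_nth q n + c * vec_nth r n = 0" by blast
  define u where "u v = (if v = p then a else if v = q then b else c)" for v
  have u: "u p = a" "u q = b" "u r = c" using assms by (auto simp: u_def)
  have "(\<Sum>v\<in>{p, q, r}. u v) = 0" using assms s u by (simp add: add.assoc)
  moreover have "a *s p + (b *s q + c *s r) = 0"
    using l by (simp add: Finite_Cartesian_Product.vec_eq_iff add.assoc)
  then have "(\<Sum>v\<in>{p, q, r}. u v *s v) = 0" using assms u by simp
  moreover have "\<exists>v\<in>{p, q, r}. u v \<noteq> 0" using nz u by auto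
  ultimately show "affinely_dependent {p, q, r}"
    unfolding affinely_dependent_def by (intro exI[of _ "{p, q, r}"] exI[of _ u]) simp
qed

lemma plane_affinely_dependent_iff:
  fixes x1 y1 x2 y2 x3 y3 :: "'k::field"
  shows "(\<exists>a b c. (a \<noteq> 0 \<or> b \<noteq> 0 \<or> c \<noteq> 0) \<and> a + b + c = 0 \<and> a * x1 + b * x2 + c * x3 = 0
      \<and> a * y1 + b * y2 + c * y3 = 0)
    \<longleftrightarrow> (x2 - x1) * (y3 - y1) = (x3 - x1) * (y2 - y1)" (is "?L \<longleftrightarrow> ?R")
proof
  assume ?L
  then obtain a b c where nz: "a \<noteq> 0 \<or> b \<noteq> 0 \<or> c \<noteq> 0"
    and e: "a + b + c = 0" "a * x1 + b * x2 + c * x3 = 0" "a * y1 + b * y2 + c * y3 = 0" by blast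
  let ?x = "\<lambda>n :: nat. if n = 0 then 1 else if n = 1 then x1 else y1"
  let ?y = "\<lambda>n :: nat. if n = 0 then 1 else if n = 1 then x2 else y2"
  let ?z = "\<lambda>n :: nat. if n = 0 then 1 else if n = 1 then x3 else y3"
  have "dep3 ?x ?y ?z"
    unfolding dep3_def using nz e by (intro exI[of _ a] exI[of _ b] exI[of _ c]) simp
  then have "det3 ?x ?y ?z 0 1 2 = 0" by (rule dep3_imp_det3)
  then have "(x1 * y2 - y1 * x2) + (y1 - y2) * x3 + (x2 - x1) * y3 = 0" by (simp add: det3_def add_ac)
  then show ?R by (simp add: algebra_simps)
next
  assume R: ?R
  \<comment> \<open>The coefficients are the 2-by-2 minors of the row of ones with the row of
    abscissas or of ordinates; they all vanish only for coinciding points.\<close>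
  consider "x2 \<noteq> x1" | "y2 \<noteq> y1" | "x2 = x1" "y2 = y1" by blast
  then show ?L
  proof cases
    case 1
    have "((x3 - x1) - (x2 - x1)) * y1 - (x3 - x1) * y2 + (x2 - x1) * y3 = 0"
      using R by (simp add: algebra_simps)
    then show ?thesis using 1
      by (intro exI[of _ "(x3 - x1) - (x2 - x1)"] exI[of _ "- (x3 - x1)"] exI[of _ "x2 - x1"])
        (simp add: algebra_simps)
  next
    case 2
    have "((y3 - y1) - (y2 - y1)) * x1 - (y3 - y1) * x2 + (y2 - y1) * x3 = 0"
      using R by (simp add: algebra_simps)
    then show ?thesis using 2
      by (intro exI[of _ "(y3 - y1) - (y2 - y1)"] exI[of _ "- (y3 - y1)"] exI[of _ "y2 - y1"])
        (simp add: algebra_simps)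
  next
    case 3
    then show ?thesis by (intro exI[of _ 1] exI[of _ "- 1"] exI[of _ 0]) simp
  qed
qed

definition plane_point :: "'m \<Rightarrow> 'm \<Rightarrow> 'k::zero \<Rightarrow> 'k \<Rightarrow> 'k ^ 'm" where
  "plane_point i j x y = (\<chi> n. if n = i then x else if n = j then y else 0)"

lemma plane_point_eq_iff:
  "i \<noteq> j \<Longrightarrow> plane_point i j x y = plane_point i j x' y' \<longleftrightarrow> x = x' \<and> y = y'"
  by (auto simp: plane_point_def Finite_Cartesian_Product.vec_eq_iff)

lemma plane_point_collinear:
  fixes x1 :: "'k::field" and i :: "'m::finite"
  assumes "i \<noteq> j" "(x1, y1) \<noteq> (x2, y2)" "(x1, y1) \<noteq> (x3, y3)" "(x2, y2) \<noteq> (x3, y3)"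
  shows "affinely_dependent {plane_point i j x1 y1, plane_point i j x2 y2, plane_point i j x3 y3}
    \<longleftrightarrow> (x2 - x1) * (y3 - y1) = (x3 - x1) * (y2 - y1)"
proof -
  have all: "(\<forall>n. a * vec_nth (plane_point i j x1 y1) n + b * vec_nth (plane_point i j x2 y2) n
      + c * vec_nth (plane_point i j x3 y3) n = 0)
    \<longleftrightarrow> a * x1 + b * x2 + c * x3 = 0 \<and> a * y1 + b * y2 + c * y3 = 0" for a b c
    using assms(1) by (auto simp: plane_point_def)
  have ne: "plane_point i j x1 y1 \<noteq> plane_point i j x2 y2" "plane_point i j x1 y1 \<noteq> plane_point i j x3 y3"
    "plane_point i j x2 y2 \<noteq> plane_point i j x3 y3"
    using assms by (simp_all add: plane_point_eq_iff)
  show ?thesis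
    unfolding affinely_dependent_triple[OF ne] all by (rule plane_affinely_dependent_iff)
qed

section \<open>Non-realizable cases\<close>

lemma AG_vector_rep:
  assumes "simple_matroid.flats_le2_realizable (UNIV :: ('k::{field,finite} ^ 'm::finite) set) affinely_independent"
  obtains V :: "'k::{field,finite} ^ 'm::finite \<Rightarrow> nat \<Rightarrow> complex" where
    "\<And>p q r. p \<noteq> q \<Longrightarrow> p \<noteq> r \<Longrightarrow> q \<noteq> r \<Longrightarrow> dep3 (V p) (V q) (V r) \<longleftrightarrow> affinely_dependent {p, q, r}"
proof -
  interpret simple_matroid "UNIV :: ('k ^ 'm) set" affinely_independent by (rule simple_matroid_AG)
  obtain l v where "vector_rep l v" using realizable_imp_vector_rep[OF assms] by blast
  then show thesis using that[of "\<lambda>p. coord l (v p)"] unfolding vector_rep_def by simp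
qed

lemma AG_not_realizable_ge4:
  fixes i j :: "'m::finite"
  assumes "i \<noteq> j" "CARD('k::{field,finite}) \<ge> 4"
  shows "\<not> simple_matroid.flats_le2_realizable (UNIV :: ('k ^ 'm) set) affinely_independent"
proof
  assume "simple_matroid.flats_le2_realizable (UNIV :: ('k ^ 'm) set) affinely_independent"
  then obtain V :: "'k ^ 'm \<Rightarrow> nat \<Rightarrow> complex" where
    V: "\<And>p q r. p \<noteq> q \<Longrightarrow> p \<noteq> r \<Longrightarrow> q \<noteq> r \<Longrightarrow> dep3 (V p) (V q) (V r) \<longleftrightarrow> affinely_dependent {p, q, r}"
    by (rule AG_vector_rep) blast
  have "affine_plane_rep (\<lambda>x y. V (plane_point i j x y))"
  proof
    fix x1 y1 x2 y2 x3 y3 :: 'k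
    consider "(x1, y1) = (x2, y2)" | "(x1, y1) = (x3, y3)" | "(x2, y2) = (x3, y3)"
      | "(x1, y1) \<noteq> (x2, y2)" "(x1, y1) \<noteq> (x3, y3)" "(x2, y2) \<noteq> (x3, y3)" by blast
    then show "dep3 (V (plane_point i j x1 y1)) (V (plane_point i j x2 y2)) (V (plane_point i j x3 y3))
      \<longleftrightarrow> (x2 - x1) * (y3 - y1) = (x3 - x1) * (y2 - y1)"
    proof cases
      case 4
      then have "plane_point i j x1 y1 \<noteq> plane_point i j x2 y2" "plane_point i j x1 y1 \<noteq> plane_point i j x3 y3"
        "plane_point i j x2 y2 \<noteq> plane_point i j x3 y3"
        by (simp_all add: plane_point_eq_iff[OF assms(1)])
      then show ?thesis using V plane_point_collinear[OF assms(1) 4] by simp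
    qed auto
  qed
  then show False using no_complex_plane_rep assms(2) by blast
qed

lemma card_3_field:
  assumes "CARD('k::{field,finite}) = 3"
  shows "(x :: 'k) = 0 \<or> x = 1 \<or> x = - 1" "(1 :: 'k) \<noteq> - 1" "1 + 1 = (- 1 :: 'k)"
proof -
  have "UNIV \<noteq> {0, 1 :: 'k}" by (rule notI, drule arg_cong[where f = card]) (simp add: assms)
  then obtain u :: 'k where u: "u \<noteq> 0" "u \<noteq> 1" by auto
  then have "card {0, 1, u} = 3" by simp
  then have U: "UNIV = {0, 1, u}" using assms by (metis card_subset_eq finite subset_UNIV)
  then have "u + 1 \<in> {0, 1, u}" by blast
  then have "u + 1 = 0" using u by auto
  then have u1: "u = - 1" by (simp add: eq_neg_iff_add_eq_0)
  then show "x = 0 \<or> x = 1 \<or> x = - 1" using U by blast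
  show ne: "(1 :: 'k) \<noteq> - 1" using u u1 by simp
  have "1 + 1 \<in> {0, 1, u}" using U by blast
  moreover have "1 + 1 \<noteq> (1 :: 'k)" by (metis add_cancel_right_right one_neq_zero)
  moreover have "1 + 1 \<noteq> (0 :: 'k)" using ne by (metis eq_neg_iff_add_eq_0)
  ultimately show "1 + 1 = (- 1 :: 'k)" using u1 by blast
qed

lemma AG_not_realizable_3:
  fixes i j l :: "'m::finite"
  assumes ijl: "i \<noteq> j" "i \<noteq> l" "j \<noteq> l" and card: "CARD('k::{field,finite}) = 3"
  shows "\<not> simple_matroid.flats_le2_realizable (UNIV :: ('k ^ 'm) set) affinely_independent"
proof
  note F = card_3_field[OF card]
  assume "simple_matroid.flats_le2_realizable (UNIV :: ('k ^ 'm) set) affinely_independent"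
  then obtain V :: "'k ^ 'm \<Rightarrow> nat \<Rightarrow> complex" where
    V: "\<And>p q r. p \<noteq> q \<Longrightarrow> p \<noteq> r \<Longrightarrow> q \<noteq> r \<Longrightarrow> dep3 (V p) (V q) (V r) \<longleftrightarrow> affinely_dependent {p, q, r}"
    by (rule AG_vector_rep) blast
  have three: "a + a + a = 0" for a :: 'k
  proof -
    have "a + a + a = a * (1 + 1 + 1)" by (simp only: distrib_left mult_1_right)
    then show ?thesis unfolding F(3) by simp
  qed
  \<comment> \<open>A vanishing coefficient would identify two of the points. Three nonzero elements
    with sum 0 in the field of three elements are equal, so a dependence is a multiple of the plain
    sum.\<close>
  have coll: "affinely_dependent {p, q, r} \<longleftrightarrow> p + q + r = 0" if ne: "p \<noteq> q" "p \<noteq> r" "q \<noteq> r" for p q r :: "'k ^ 'm"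
  proof
    assume "p + q + r = 0"
    then have "vec_nth p n + vec_nth q n + vec_nth r n = 0" for n
      by (metis vector_add_component zero_index)
    then show "affinely_dependent {p, q, r}"
      unfolding affinely_dependent_triple[OF ne] using three[of 1]
      by (intro exI[of _ 1]) simp
  next
    assume "affinely_dependent {p, q, r}"
    then obtain a b c where nz: "a \<noteq> 0 \<or> b \<noteq> 0 \<or> c \<noteq> 0" and s: "a + b + c = 0"
      and e: "\<And>n. a * vec_nth p n + b * vec_nth q n + c * vec_nth r n = 0"
      unfolding affinely_dependent_triple[OF ne] by blast
    have eq: "u = w" if "d \<noteq> 0" "\<And>n. d * vec_nth u n = d * vec_nth w n" for d and u w :: "'k ^ 'm"
      using that by (simp add: Finite_Cartesian_Product.vec_eq_iff)
    have c: "c = - a - b" using s by (simp add: algebra_simps eq_neg_iff_add_eq_0)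
    have "a \<noteq> 0"
    proof
      assume "a = 0"
      then have "b \<noteq> 0" "\<And>n. b * vec_nth q n = b * vec_nth r n" using nz c e by auto
      then show False using eq[of b q r] ne by blast
    qed
    moreover have "b \<noteq> 0"
    proof
      assume "b = 0"
      then have "a \<noteq> 0" "\<And>n. a * vec_nth p n = a * vec_nth r n" using nz c e by auto
      then show False using eq[of a p r] ne by blast
    qed
    moreover have "c \<noteq> 0"
    proof
      assume "c = 0"
      then have b: "b = - a" using c by simp
      then have "a \<noteq> 0" "\<And>n. a * vec_nth p n = a * vec_nth q n" using nz \<open>c = 0\<close> e by auto
      then show False using eq[of a p q] ne by blast
    qed
    ultimately have "a = b" using F(1)[of a] F(1)[of b] c by auto
    moreover from this have "a + b + a = 0" using three[of a] by simp
    then have "c = a" using s by (metis add_left_cancel)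
    ultimately have "a * (vec_nth p n + vec_nth q n + vec_nth r n) = 0" for n using e[of n] by (simp add: distrib_left)
    then show "p + q + r = 0" using \<open>a \<noteq> 0\<close> by (simp add: Finite_Cartesian_Product.vec_eq_iff)
  qed
  have thr: "x + x + x = 0" for x :: "'k ^ 'm" using three by (simp add: Finite_Cartesian_Product.vec_eq_iff)
  define a b c :: "'k ^ 'm" where "a = axis i 1" and "b = axis j 1" and "c = axis l 1"
  have comp: "vec_nth a i = 1" "vec_nth a j = 0" "vec_nth a l = 0" "vec_nth b i = 0" "vec_nth b j = 1" "vec_nth b l = 0"
    "vec_nth c i = 0" "vec_nth c j = 0" "vec_nth c l = 1"
    using ijl unfolding a_def b_def c_def axis_def by auto
  have neq: "u \<noteq> w" if "vec_nth u n \<noteq> vec_nth w n" for u w :: "'k ^ 'm" and n using that by auto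
  interpret elementary_3_rep V
  proof
    fix p q r :: "'k ^ 'm"
    show "dep3 (V p) (V q) (V r) \<longleftrightarrow> p = q \<or> q = r \<or> p = r \<or> p + q + r = 0"
    proof (cases "p = q \<or> q = r \<or> p = r")
      case True
      then show ?thesis by auto
    next
      case False
      then show ?thesis using V[of p q r] coll[of p q r] by blast
    qed
    show "\<exists>x. x \<noteq> p \<and> x \<noteq> q \<and> x \<noteq> r"
    proof (rule ccontr)
      assume "\<not> ?thesis"
      then have "{0, a, b, a + b} \<subseteq> {p, q, r}" by blast
      then have "card {0, a, b, a + b} \<le> card {p, q, r}" by (intro card_mono) auto
      also have "\<dots> \<le> 3" by (simp add: card_insert_if)
      finally have "card {0, a, b, a + b} \<le> 3" .
      moreover have "0 \<noteq> a" "a \<noteq> b" "0 \<noteq> a + b" by (rule neq[of _ i]; simp add: comp)+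
      moreover have "0 \<noteq> b" "a \<noteq> a + b" by (rule neq[of _ j]; simp add: comp)+
      moreover have "b \<noteq> a + b" by (rule neq[of _ i]; simp add: comp)
      ultimately show False by simp
    qed
  qed (rule thr)
  have "a \<noteq> 0" "a \<noteq> b" "a \<noteq> - b" by (rule neq[of _ i]; simp add: comp)+
  moreover have "b \<noteq> 0" by (rule neq[of _ j]; simp add: comp)
  ultimately have "ind a b" unfolding ind_def by blast
  moreover have "c \<noteq> 0" "c \<noteq> a" "c \<noteq> - a" "c \<noteq> b" "c \<noteq> - b" "c \<noteq> a + b" "c \<noteq> - (a + b)" "c \<noteq> a - b" "c \<noteq> b - a"
    by (rule neq[of _ l]; simp add: comp)+
  then have "c \<notin> {0, a, - a, b, - b, a + b, - (a + b), a - b, b - a}" by blast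
  ultimately show False by (rule no_three_independent)
qed

section \<open>The dual Hesse arrangement\<close>

lemma primitive_cube_root: "\<exists>w :: complex. w\<^sup>2 + w + 1 = 0"
  by (rule exI[of _ "Complex (-1/2) (sqrt 3 / 2)"]) (simp add: complex_eq_iff power2_eq_square)

text \<open>With only three nonzero coordinates every minor is 0 or, up to sign, this one.\<close>

lemma dep3_iff_det3:
  fixes u v w :: "nat \<Rightarrow> 'c::field"
  assumes "\<And>n. n \<ge> 3 \<Longrightarrow> u n = 0 \<and> v n = 0 \<and> w n = 0"
  shows "dep3 u v w \<longleftrightarrow> det3 u v w 0 1 2 = 0"
proof
  assume z: "det3 u v w 0 1 2 = 0"
  have same: "det3 u v w i i k = 0" "det3 u v w k i i = 0" "det3 u v w i k i = 0" for i k
    by (simp_all add: det3_def algebra_simps)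
  have "det3 u v w 0 2 1 = - det3 u v w 0 1 2" "det3 u v w 1 0 2 = - det3 u v w 0 1 2"
    "det3 u v w 1 2 0 = det3 u v w 0 1 2" "det3 u v w 2 0 1 = det3 u v w 0 1 2" "det3 u v w 2 1 0 = - det3 u v w 0 1 2"
    by (simp_all add: det3_def algebra_simps)
  note perm = this[unfolded z minus_zero]
  have "det3 u v w i j k = 0" for i j k
  proof (cases "i \<ge> 3 \<or> j \<ge> 3 \<or> k \<ge> 3")
    case True
    then show ?thesis using assms by (auto simp: det3_def)
  next
    case False
    then have "i = 0 \<or> i = 1 \<or> i = 2" "j = 0 \<or> j = 1 \<or> j = 2" "k = 0 \<or> k = 1 \<or> k = 2" by auto
    then show ?thesis by (elim disjE) (simp_all only: z perm same)
  qed
  then show "dep3 u v w" using indep3_imp_det3 by metis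
qed (rule dep3_imp_det3)

text \<open>The normals of the dual Hesse arrangement: the nine inflection points of the Fermat cubic.\<close>

definition hesse :: "('k::field \<Rightarrow> complex) \<Rightarrow> 'k \<Rightarrow> 'k \<Rightarrow> nat \<Rightarrow> complex" where
  "hesse h x y n = (if n \<ge> 3 then 0 else if of_nat n = x then 0 else if of_nat n = x + 1 then 1 else - h y)"

text \<open>\<open>h\<close> is an injective character of the additive group into the cube roots of
  unity, and \<open>x\<close> marks the position of the zero. Points with equal \<open>x\<close>
  share a coordinate line; two different ones of them are never dependent with a point of another
  \<open>x\<close>. For abscissas 0, 1, -1 the determinant is \<open>1 - h a * (h b * h c)\<close>,
  which vanishes exactly if \<open>a + b + c = 0\<close>.\<close>

lemma hesse_collinear:
  assumes card: "CARD('k::{field,finite}) = 3" and w: "w\<^sup>2 + w + 1 = 0"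
    and h: "h = (\<lambda>y :: 'k. if y = 0 then 1 else if y = 1 then w else w\<^sup>2)"
  shows "dep3 (hesse h x1 y1) (hesse h x2 y2) (hesse h x3 y3)
    \<longleftrightarrow> (x2 - x1) * (y3 - y1) = (x3 - x1) * (y2 - y1)"
proof -
  note F = card_3_field[OF card]
  have two: "(2 :: 'k) = - 1" using F(3) by simp
  have ne: "(1 :: 'k) \<noteq> - 1" "(- 1 :: 'k) \<noteq> 1" using F(2) by simp_all
  have wn: "w \<noteq> 0" "w \<noteq> 1" using w by auto
  have w3: "w ^ 3 = 1"
  proof -
    have "w ^ 3 - 1 = (w - 1) * (w\<^sup>2 + w + 1)" by (simp add: algebra_simps power2_eq_square power3_eq_cube)
    then show ?thesis using w by simp
  qed
  have c: "h 0 = 1" "h 1 = w" "h (- 1) = w * w" using ne by (simp_all add: h power2_eq_square)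
  have w2: "w * w = - 1 - w" using w by (simp add: power2_eq_square algebra_simps eq_neg_iff_add_eq_0)
  have w3': "w * (w * w) = 1" using w3 by (simp add: power3_eq_cube mult.assoc)
  have hom: "h (a + b) = h a * h b" for a b
  proof -
    have "(- 1) + (- 1) = (1 :: 'k)" "1 + 1 = (- 1 :: 'k)" "1 + (- 1) = (0 :: 'k)" "- 1 + 1 = (0 :: 'k)"
      using F(3) by (simp_all add: two)
    moreover have "w * w * w = 1" "w * w * (w * w) = w" using w3' by (metis mult.assoc mult_1_right)+
    ultimately show ?thesis
      using F(1)[of a] F(1)[of b] w3' by (elim disjE) (simp_all only: c add_0_left add_0_right mult_1_left mult_1_right)
  qed
  have eq1: "h a = 1 \<longleftrightarrow> a = 0" for a
  proof -
    have "w * w \<noteq> 1" using w3' wn by auto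
    then show ?thesis using F(1)[of a] wn by (elim disjE) (simp_all add: c)
  qed
  have nz: "h a \<noteq> 0" for a using F(1)[of a] wn by (auto simp: c)
  have inj: "h a = h b \<longleftrightarrow> a = b" for a b
  proof -
    have "h (a - b) * h b = h a" by (simp add: hom[symmetric])
    then show ?thesis using eq1[of "a - b"] nz[of b] by auto
  qed
  have K: "h a * (h b * h c) = 1 \<longleftrightarrow> a + b + c = 0" for a b c
    using eq1[of "a + b + c"] by (simp add: hom mult.assoc)
  \<comment> \<open>In characteristic 3 arithmetic progressions are the triples with sum 0.\<close>
  have S: "a - b = b - c \<longleftrightarrow> a + b + c = 0" for a b c :: 'k
  proof -
    have "b + b = b * (1 + 1)" by (simp only: distrib_left mult_1_right)
    then have "b + b = - b" using F(3) by simp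
    have e: "a - b = b - c \<longleftrightarrow> a + c = b + b" by (auto simp: algebra_simps)
    show ?thesis unfolding e \<open>b + b = - b\<close> by (simp only: eq_neg_iff_add_eq_0 add_ac)
  qed
  have row: "hesse h 0 y 0 = 0" "hesse h 0 y 1 = 1" "hesse h 0 y 2 = - h y"
    "hesse h 1 y 0 = - h y" "hesse h 1 y 1 = 0" "hesse h 1 y 2 = 1"
    "hesse h (- 1) y 0 = 1" "hesse h (- 1) y 1 = - h y" "hesse h (- 1) y 2 = 0" for y
    using ne by (simp_all add: hesse_def two)
  \<comment> \<open>Naming the claim makes its symmetry usable: swaps reduce it to a repeated
    abscissa or to the abscissas 0, 1, -1 in this order.\<close>
  define Q where "Q x1 y1 x2 y2 x3 y3 \<longleftrightarrow>
      (dep3 (hesse h x1 y1) (hesse h x2 y2) (hesse h x3 y3) \<longleftrightarrow> (x2 - x1) * (y3 - y1) = (x3 - x1) * (y2 - y1))"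
    for x1 y1 x2 y2 x3 y3
  have "(x2 - x1) * (y3 - y1) = (x3 - x1) * (y2 - y1) \<longleftrightarrow> (x1 - x2) * (y3 - y2) = (x3 - x2) * (y1 - y2)"
    for x1 y1 x2 y2 x3 y3 :: 'k
    by (auto simp: algebra_simps)
  then have Q12: "Q x1 y1 x2 y2 x3 y3 \<longleftrightarrow> Q x2 y2 x1 y1 x3 y3" for x1 y1 x2 y2 x3 y3
    unfolding Q_def using dep3_swap12 by metis
  have Q23: "Q x1 y1 x2 y2 x3 y3 \<longleftrightarrow> Q x1 y1 x3 y3 x2 y2" for x1 y1 x2 y2 x3 y3
    unfolding Q_def using dep3_swap23 by metis
  have det: "dep3 (hesse h x1 y1) (hesse h x2 y2) (hesse h x3 y3)
    \<longleftrightarrow> det3 (hesse h x1 y1) (hesse h x2 y2) (hesse h x3 y3) 0 1 2 = 0" for x1 y1 x2 y2 x3 y3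
    by (rule dep3_iff_det3) (simp add: hesse_def)
  have Q_same: "Q x y1 x y2 x3 y3" for x y1 y2 x3 y3
  proof (cases "x3 = x")
    case True
    have "det3 (hesse h x y1) (hesse h x y2) (hesse h x y3) 0 1 2 = 0"
      using F(1)[of x] by (elim disjE) (simp_all only: det3_def row, simp_all)
    then show ?thesis unfolding Q_def det True by simp
  next
    case False
    have "det3 (hesse h x y1) (hesse h x y2) (hesse h x3 y3) 0 1 2 = 0 \<longleftrightarrow> h y1 = h y2"
      using F(1)[of x] F(1)[of x3] False by (elim disjE) (simp_all only: det3_def row, auto simp: nz)
    then show ?thesis unfolding Q_def det inj using False by auto
  qed
  have "det3 (hesse h 0 a) (hesse h 1 b) (hesse h (- 1) c) 0 1 2 = 1 - h a * (h b * h c)" for a b c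
    unfolding det3_def row by simp
  then have "dep3 (hesse h 0 a) (hesse h 1 b) (hesse h (- 1) c) \<longleftrightarrow> a + b + c = 0" for a b c
    unfolding det K[symmetric] by auto
  moreover have "(1 - 0) * (c - a) = (- 1 - 0) * (b - a) \<longleftrightarrow> a + b + c = 0" for a b c :: 'k
    using S[of c a b] by (simp add: ac_simps)
  ultimately have Q_dist: "Q 0 a 1 b (- 1) c" for a b c unfolding Q_def by blast
  have "Q x1 y1 x2 y2 x3 y3"
  proof (cases "x1 = x2 \<or> x1 = x3 \<or> x2 = x3")
    case True
    then show ?thesis using Q_same Q12 Q23 by metis
  next
    case False
    then consider "x1 = 0" "x2 = 1" "x3 = - 1" | "x1 = 0" "x2 = - 1" "x3 = 1" | "x1 = 1" "x2 = 0" "x3 = - 1"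
      | "x1 = 1" "x2 = - 1" "x3 = 0" | "x1 = - 1" "x2 = 0" "x3 = 1" | "x1 = - 1" "x2 = 1" "x3 = 0"
      using F(1)[of x1] F(1)[of x2] F(1)[of x3] by metis
    then show ?thesis using Q_dist Q12 Q23 by cases metis+
  qed
  then show ?thesis unfolding Q_def .
qed

lemma AG_2_3_realizable:
  fixes i j :: "'m::finite"
  assumes ij: "i \<noteq> j" "UNIV = {i, j}" and card: "CARD('k::{field,finite}) = 3"
  shows "simple_matroid.flats_le2_realizable (UNIV :: ('k ^ 'm) set) affinely_independent"
proof -
  interpret simple_matroid "UNIV :: ('k ^ 'm) set" affinely_independent by (rule simple_matroid_AG)
  obtain w :: complex where w: "w\<^sup>2 + w + 1 = 0" using primitive_cube_root by blast
  define h :: "'k \<Rightarrow> complex" where "h = (\<lambda>y. if y = 0 then 1 else if y = 1 then w else w\<^sup>2)"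
  define v where "v p = Matrix.vec 3 (hesse h (vec_nth p i) (vec_nth p j))" for p :: "'k ^ 'm"
  have coord: "coord 3 (v p) = hesse h (vec_nth p i) (vec_nth p j)" for p
    by (auto simp: coord_def v_def hesse_def fun_eq_iff)
  have pt: "plane_point i j (vec_nth p i) (vec_nth p j) = p" for p :: "'k ^ 'm"
  proof -
    have "n = i \<or> n = j" for n using ij(2) by blast
    then show ?thesis using ij(1) by (auto simp: plane_point_def Finite_Cartesian_Product.vec_eq_iff)
  qed
  have ne: "(vec_nth p i, vec_nth p j) \<noteq> (vec_nth q i, vec_nth q j)" if "p \<noteq> q" for p q :: "'k ^ 'm"
    using pt[of p] pt[of q] that by auto
  have coll: "affinely_dependent {p, q, r} \<longleftrightarrow> (vec_nth q i - vec_nth p i) * (vec_nth r j - vec_nth p j)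
      = (vec_nth r i - vec_nth p i) * (vec_nth q j - vec_nth p j)"
    if "p \<noteq> q" "p \<noteq> r" "q \<noteq> r" for p q r :: "'k ^ 'm"
    using plane_point_collinear[OF ij(1) ne[OF that(1)] ne[OF that(2)] ne[OF that(3)]] unfolding pt .
  have rep: "vector_rep 3 v"
    unfolding vector_rep_def coord hesse_collinear[OF card w h_def] using coll by (simp add: v_def)
  show ?thesis
  proof (rule vector_rep_imp_realizable[OF rep])
    fix p q :: "'k ^ 'm" assume pq: "p \<noteq> q"
    \<comment> \<open>\<open>p\<close> moved along a coordinate axis that is not parallel to the
      line through \<open>p\<close> and \<open>q\<close>.\<close>
    define r :: "'k ^ 'm" where "r = (if vec_nth p i = vec_nth q i then plane_point i j (vec_nth p i + 1) (vec_nth p j)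
      else plane_point i j (vec_nth p i) (vec_nth p j + 1))"
    have r: "(vec_nth q i - vec_nth p i) * (vec_nth r j - vec_nth p j) \<noteq> (vec_nth r i - vec_nth p i) * (vec_nth q j - vec_nth p j)"
      using ne[OF pq] ij(1) by (auto simp: r_def plane_point_def)
    then have "p \<noteq> r" "q \<noteq> r" by auto
    with coll[OF pq this] r show "\<exists>r\<in>UNIV. r \<noteq> p \<and> r \<noteq> q \<and> affinely_independent {p, q, r}"
      by (intro bexI[of _ r]) auto
  next
    fix p :: "'k ^ 'm"
    have "p + axis i 1 \<noteq> p" by (simp add: axis_eq_0_iff)
    then show "\<exists>q\<in>UNIV. q \<noteq> p" by blast
  qed
qed

theorem corollary9p8:
  fixes p s k m :: nat
  assumes "prime p"
    and "k = p ^ s"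
    and "CARD('k::{field,finite}) = k"
    and "CARD('m::finite) = m"
    and "m \<ge> 2"
    and "k \<ge> 3"
  shows "simple_matroid.flats_le2_realizable (UNIV :: ('k ^ 'm) set) affinely_independent
           \<longleftrightarrow> m = 2 \<and> k = 3"
proof
  assume real: "simple_matroid.flats_le2_realizable (UNIV :: ('k ^ 'm) set) affinely_independent"
  obtain T :: "'m set" where "card T = 2" using obtain_subset_with_card_n[of 2 UNIV] assms(4,5) by metis
  then obtain i j :: 'm where "i \<noteq> j" by (auto simp: card_2_iff)
  then have k: "k = 3" using AG_not_realizable_ge4[of i j, where 'k = 'k] real assms(3,6) by force
  have "\<not> 3 \<le> m"
  proof
    assume "3 \<le> m"
    then obtain T :: "'m set" where "card T = 3" using obtain_subset_with_card_n[of 3 UNIV] assms(4) by metis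
    then obtain i j l :: 'm where "i \<noteq> j" "i \<noteq> l" "j \<noteq> l" by (auto simp: card_3_iff)
    then show False using AG_not_realizable_3[of i j l, where 'k = 'k] real assms(3) k by blast
  qed
  then show "m = 2 \<and> k = 3" using k assms(5) by simp
next
  assume mk: "m = 2 \<and> k = 3"
  then have "card (UNIV :: 'm set) = 2" using assms(4) by simp
  then obtain i j :: 'm where "UNIV = {i, j}" "i \<noteq> j" by (auto simp: card_2_iff)
  then show "simple_matroid.flats_le2_realizable (UNIV :: ('k ^ 'm) set) affinely_independent"
    using AG_2_3_realizable mk assms(3) by blast
qed

end
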